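(* Let $\mathcal{F}=\{f_0\}\cup\{f_p\colon p\in\mathcal{P}\}$ be a uniform covering frame on $\mathbb{R}^d$. There exists a constant $C_0\in(0,1)$, depending only on $\mathcal{F}$, such that for all $f\in L^2(\mathbb{R}^d)$ and integers $K\geq1$, $$C_0^{K-1}\|f*f_0\|_{L^2}^2+\sum_{p\in\mathcal{P}^K}\|U[p]f\|_{L^2}^2\leq C_0^{K-1}\|f\|_{L^2}^2.$$
   Context: Fourier transform: $\hat f(\xi)=\int_{\mathbb{R}^d}f(x)e^{-2\pi i x\cdot\xi}\,dx$, extended to $L^2(\mathbb{R}^d)$. $|y|_\infty$ is the sup norm, and $Q_R(x)=\{y\in\mathbb{R}^d\colon |y-x|_\infty<R\}$ is the open cube of side length $2R$ centered at $x$. Supports are essential supports (complement of the largest open set where the function vanishes a.e.). Uniform covering frame: Let $\mathcal{P}$ be a countably infinite index set. A uniform covering frame is a family of functions $\mathcal{F}=\{f_0\}\cup\{f_p\colon p\in\mathcal{P}\}$ such that: (i) $f_0\in L^1(\mathbb{R}^d)\cap L^2(\mathbb{R}^d)\cap C^1(\mathbb{R}^d)$, $\hat f_0$ is supported in a compact neighborhood of the origin, and $|\hat f_0(0)|=1$; for each $p\in\mathcal{P}$, $f_p\in L^1(\mathbb{R}^d)\cap L^2(\mathbb{R}^d)$ and $\mathrm{supp}(\hat f_p)$ is compact and connected. (ii) (Uniform covering property) For any $R>0$ there is an integer $N>0$ such that for each $p\in\mathcal{P}$ the set $\mathrm{supp}(\hat f_p)$ can be covered by $N$ cubes of side length $2R$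 (of the form $Q_R(x)$). (iii) (Frame condition) $|\hat f_0(\xi)|^2+\sum_{p\in\mathcal{P}}|\hat f_p(\xi)|^2=1$ for all $\xi\in\mathbb{R}^d$. Scattering propagator: for $k\ge 1$, $\mathcal{P}^k$ is the $k$-fold Cartesian product. For $p\in\mathcal{P}$, $U[p]f=|f*f_p|$ (pointwise complex modulus); for $p=(p_1,\dots,p_k)\in\mathcal{P}^k$, $U[p]f=U[p_k]U[p_{k-1}]\cdots U[p_1]f$. *)

theory Defs
  imports "HOL-Analysis.Analysis"
begin

definition in_L1 :: "(real^'d \<Rightarrow> complex) \<Rightarrow> bool" where
  "in_L1 f \<longleftrightarrow> integrable lebesgue f"

definition in_L2 :: "(real^'d \<Rightarrow> complex) \<Rightarrow> bool" where
  "in_L2 f \<longleftrightarrow> f \<in> borel_measurable lebesgue \<and> integrable lebesgue (\<lambda>x. (cmod (f x))\<^sup>2)"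

text \<open>The squared L2 norm takes values in \<^typ>\<open>ennreal\<close>, so that it is \<open>\<infinity>\<close>
  (and not 0) for a measurable function that is not square integrable.\<close>

definition L2_norm_sq :: "(real^'d \<Rightarrow> complex) \<Rightarrow> ennreal" where
  "L2_norm_sq f = (\<integral>\<^sup>+ x. ennreal ((cmod (f x))\<^sup>2) \<partial>lebesgue)"

definition in_C1 :: "(real^'d \<Rightarrow> complex) \<Rightarrow> bool" where
  "in_C1 f \<longleftrightarrow> (\<exists>f' :: (real^'d) \<Rightarrow> ((real^'d) \<Rightarrow>\<^sub>L complex).
     (\<forall>x. (f has_derivative blinfun_apply (f' x)) (at x)) \<and> continuous_on UNIV f')"

text \<open>Only Fourier transforms of functions in \<open>L\<^sup>1 \<inter> L\<^sup>2\<close> occur below, so the integral formula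
  suffices and defines the transform at every point.\<close>

definition fourier :: "(real^'d \<Rightarrow> complex) \<Rightarrow> real^'d \<Rightarrow> complex" where
  "fourier f \<xi> = (LINT x|lebesgue. f x * exp (- 2 * complex_of_real pi * \<i> * complex_of_real (x \<bullet> \<xi>)))"

definition convolution :: "(real^'d \<Rightarrow> complex) \<Rightarrow> (real^'d \<Rightarrow> complex) \<Rightarrow> real^'d \<Rightarrow> complex" where
  "convolution f g x = (LINT y|lebesgue. f y * g (x - y))"

definition ess_supp :: "(real^'d \<Rightarrow> complex) \<Rightarrow> (real^'d) set" where
  "ess_supp g = - \<Union>{V. open V \<and> (AE x in lebesgue. x \<in> V \<longrightarrow> g x = 0)}"

definition cube :: "real \<Rightarrow> real^'d \<Rightarrow> (real^'d) set" where
  "cube R x = {y. infnorm (y - x) < R}"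

text \<open>The centres \<open>c i\<close> need not be distinct. This does not change the covering property, since
  superfluous cubes can be added to any cover.\<close>

definition uniform_covering_frame ::
  "'p set \<Rightarrow> (real^'d \<Rightarrow> complex) \<Rightarrow> ('p \<Rightarrow> real^'d \<Rightarrow> complex) \<Rightarrow> bool" where
  "uniform_covering_frame P f0 F \<longleftrightarrow>
     countable P \<and> infinite P \<and>
     in_L1 f0 \<and> in_L2 f0 \<and> in_C1 f0 \<and>
     (\<exists>S. compact S \<and> 0 \<in> interior S \<and> ess_supp (fourier f0) \<subseteq> S) \<and>
     cmod (fourier f0 0) = 1 \<and>
     (\<forall>p\<in>P. in_L1 (F p) \<and> in_L2 (F p) \<and>
        compact (ess_supp (fourier (F p))) \<and> connected (ess_supp (fourier (F p)))) \<and>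
     (\<forall>R>0. \<exists>N::nat. N > 0 \<and>
        (\<forall>p\<in>P. \<exists>c :: nat \<Rightarrow> real^'d. ess_supp (fourier (F p)) \<subseteq> (\<Union>i<N. cube R (c i)))) \<and>
     (\<forall>\<xi>. (\<lambda>p. (cmod (fourier (F p) \<xi>))\<^sup>2) summable_on P \<and>
        (cmod (fourier f0 \<xi>))\<^sup>2 + (\<Sum>\<^sub>\<infinity>p\<in>P. (cmod (fourier (F p) \<xi>))\<^sup>2) = 1)"

definition propagator1 ::
  "('p \<Rightarrow> real^'d \<Rightarrow> complex) \<Rightarrow> 'p \<Rightarrow> (real^'d \<Rightarrow> complex) \<Rightarrow> real^'d \<Rightarrow> complex" where
  "propagator1 F p f = (\<lambda>x. complex_of_real (cmod (convolution f (F p) x)))"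

text \<open>A tuple \<open>(p\<^sub>1, \<dots>, p\<^sub>k)\<close> is the list \<open>[p\<^sub>1, \<dots>, p\<^sub>k]\<close>; \<^const>\<open>fold\<close> applies the
  operator of \<open>p\<^sub>1\<close> first.\<close>

definition propagator ::
  "('p \<Rightarrow> real^'d \<Rightarrow> complex) \<Rightarrow> 'p list \<Rightarrow> (real^'d \<Rightarrow> complex) \<Rightarrow> real^'d \<Rightarrow> complex" where
  "propagator F ps f = fold (propagator1 F) ps f"

definition paths :: "'p set \<Rightarrow> nat \<Rightarrow> 'p list set" where
  "paths P k = {ps. length ps = k \<and> set ps \<subseteq> P}"

end

theory Submission
  imports "HOL-Probability.Characteristic_Functions" Defs
begin

text \<open>
  By Plancherel and the frame condition, a signal \<open>h\<close> splits its energy among the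
  outputs \<open>h * f\<^sub>0\<close> and \<open>h * f\<^sub>p\<close>. So it suffices that every signal \<open>h = |g|\<close> with
  \<open>g = u * f\<^sub>p\<close> sends a fixed fraction of its energy to the low-pass output, and the
  contraction then multiplies along paths. For this, choose \<open>\<phi> \<ge> 0\<close> with \<open>|\<phi>^| \<le> |f\<^sub>0^|\<close> and
  \<open>|\<phi>^| \<ge> c\<close> on a small cube about 0. As \<open>\<phi> \<ge> 0\<close>, the function \<open>|g| * \<phi>\<close> dominates
  \<open>|g * M\<phi>|\<close> for every modulation \<open>M\<close>, so \<open>\<parallel>|g| * f\<^sub>0\<parallel>\<^sup>2\<close> is at least \<open>c\<^sup>2\<close> times the energy of
  \<open>g^\<close> on any translate of that cube. Since \<open>N\<close> translates cover the support of
  \<open>g^\<close>, with \<open>N\<close> independent of \<open>p\<close>, one of them carries a share \<open>1/N\<close> of the energy.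

  Only two halves of Plancherel are needed: \<open>\<parallel>f^\<parallel> \<le> \<parallel>f\<parallel>\<close>, by Gaussian regularisation, and
  \<open>\<parallel>f\<parallel> \<le> \<parallel>f^\<parallel>\<close> for continuous \<open>f\<close> with integrable \<open>f^\<close>, by applying the first half to \<open>f^\<close> and
  inverting. Everything else on \<open>L\<^sup>2\<close> follows by density and Fatou's lemma.
\<close>

section \<open>Gaussian integrals\<close>

text \<open>Change of variables in the form needed below: \<open>c = 1\<close> gives translations,
  \<open>c = -1\<close> reflections, and a positive \<open>c\<close> dilations with their
  Jacobian.\<close>

lemma nn_integral_lborel_affine:
  fixes f :: "'a::euclidean_space \<Rightarrow> ennreal"
  assumes [measurable]: "f \<in> borel_measurable borel" and "c \<noteq> 0"
  shows "(\<integral>\<^sup>+x. f x \<partial>lborel) = ennreal (\<bar>c\<bar> ^ DIM('a)) * (\<integral>\<^sup>+x. f (t + c *\<^sub>R x) \<partial>lborel)"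
  by (subst lborel_affine[OF \<open>c \<noteq> 0\<close>, of t]) (simp add: nn_integral_density nn_integral_distr nn_integral_cmult ennreal_power)

lemma integrable_lborel_affine_iff:
  fixes f :: "'a::euclidean_space \<Rightarrow> 'b::{banach, second_countable_topology}"
  assumes "f \<in> borel_measurable borel" "c \<noteq> 0"
  shows "integrable lborel (\<lambda>x. f (t + c *\<^sub>R x)) \<longleftrightarrow> integrable lborel f"
proof -
  have "integrable lborel f \<longleftrightarrow> integrable (density (distr lborel borel (\<lambda>x. t + c *\<^sub>R x)) (\<lambda>_. ennreal (\<bar>c\<bar> ^ DIM('a)))) f"
    using lborel_affine[OF \<open>c \<noteq> 0\<close>, of t] by simp
  also have "\<dots> \<longleftrightarrow> integrable lborel (\<lambda>x. f (t + c *\<^sub>R x))"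
  proof -
    have *: "integrable lborel (\<lambda>x. r *\<^sub>R g x) \<longleftrightarrow> integrable lborel g" if "r > 0" for r :: real and g :: "'a \<Rightarrow> 'b"
      using integrable_scaleR_right[of r lborel g] integrable_scaleR_right[of "1/r" lborel "\<lambda>x. r *\<^sub>R g x"] that by auto
    show ?thesis
      using assms by (simp add: integrable_density integrable_distr_eq *)
  qed
  finally show ?thesis by simp
qed

lemma integral_lborel_affine:
  fixes f :: "'a::euclidean_space \<Rightarrow> 'b::{banach, second_countable_topology}"
  assumes "f \<in> borel_measurable borel" "c \<noteq> 0"
  shows "(LINT x|lborel. f x) = (\<bar>c\<bar> ^ DIM('a)) *\<^sub>R (LINT x|lborel. f (t + c *\<^sub>R x))"
  by (subst lborel_affine[OF \<open>c \<noteq> 0\<close>, of t]) (use assms in \<open>simp add: integral_density integral_distr\<close>)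

text \<open>The kernel of \<open>fourier\<close> as a character of the real inner product.
  Translating a signal or its transform then amounts to \<open>chi_add\<close>.\<close>

definition chi :: "real \<Rightarrow> complex" where
  "chi t = exp (- 2 * complex_of_real pi * \<i> * complex_of_real t)"

lemma cmod_chi [simp]: "cmod (chi t) = 1"
  unfolding chi_def by (simp add: norm_exp_eq_Re)

lemma chi_0 [simp]: "chi 0 = 1"
  by (simp add: chi_def)

lemma chi_add: "chi (s + t) = chi s * chi t"
  by (simp add: chi_def exp_add[symmetric] algebra_simps)

lemma chi_sum: "chi (\<Sum>i\<in>A. f i) = (\<Prod>i\<in>A. chi (f i))"
  by (induction A rule: infinite_finite_induct) (auto simp: chi_add)

lemma cnj_chi: "cnj (chi t) = chi (- t)"
  by (simp add: chi_def exp_cnj)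

lemma continuous_on_chi [continuous_intros]:
  "continuous_on S f \<Longrightarrow> continuous_on S (\<lambda>x. chi (f x))"
  unfolding chi_def by (intro continuous_intros)

lemma chi_measurable [measurable]: "chi \<in> borel_measurable borel"
  by (intro borel_measurable_continuous_onI continuous_intros)

text \<open>This is the characteristic function of the standard normal distribution at
  \<open>- c * s\<close>. The substitution \<open>x = c * t\<close> with
  \<open>c = sqrt (2 * pi)\<close> turns the density into \<open>exp (- pi * t\<^sup>2) / c\<close>,
  and its Jacobian cancels the factor \<open>1 / c\<close>.\<close>

lemma gauss_integral_real:
  fixes s :: real
  shows "integrable lborel (\<lambda>t. exp (- pi * t\<^sup>2))"
    and "(LINT t|lborel. complex_of_real (exp (- pi * t\<^sup>2)) * chi (t * s)) 
      = complex_of_real (exp (- pi * s\<^sup>2))"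
proof -
  define c where "c = sqrt (2 * pi)"
  have c: "c > 0" "c\<^sup>2 = 2 * pi" by (auto simp: c_def)
  have 1: "integrable lborel (\<lambda>x. std_normal_density x)" using integrable_std_normal_moment[of 0] by simp
  have 2: "integrable lborel (\<lambda>x. std_normal_density (0 + c *\<^sub>R x))"
    by (subst integrable_lborel_affine_iff) (use 1 c in auto)
  have "std_normal_density (0 + c *\<^sub>R x) = exp (- pi * x\<^sup>2) / c" for x
    unfolding std_normal_density_def c_def[symmetric] by (simp add: c power_mult_distrib)
  note e = this
  show "integrable lborel (\<lambda>t. exp (- pi * t\<^sup>2))"
    using integrable_mult_right[OF 2[unfolded e], of c] c by simp
  have "complex_of_real (exp (- pi * s\<^sup>2)) = char std_normal_distribution (- c * s)"
  proof -
    have "- ((- c * s)\<^sup>2) / 2 = - pi * s\<^sup>2" by (simp add: power_mult_distrib c(2))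
    then show ?thesis by (simp only: char_std_normal_distribution)
  qed
  also have "\<dots> = (LINT x|lborel. std_normal_density x *\<^sub>R iexp (- c * s * x))"
    unfolding char_def by (subst integral_density) (auto simp: normal_density_nonneg)
  also have "\<dots> = (\<bar>c\<bar> ^ DIM(real)) *\<^sub>R (LINT x|lborel. std_normal_density (0 + c *\<^sub>R x) *\<^sub>R iexp (- c * s * (0 + c *\<^sub>R x)))"
    using c by (intro integral_lborel_affine) auto
  also have "\<dots> = (LINT t|lborel. complex_of_real (exp (- pi * t\<^sup>2)) * chi (t * s))"
  proof -
    have "- c * s * (0 + c *\<^sub>R x) = - (c\<^sup>2) * (x * s)" for x
      by (simp add: power2_eq_square)
    note r = this
    show ?thesis
      unfolding e r c(2) integral_scaleR_right[symmetric]
    proof (intro Bochner_Integration.integral_cong refl)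
      fix x :: real
      show "\<bar>c\<bar> ^ DIM(real) *\<^sub>R (exp (- pi * x\<^sup>2) / c) *\<^sub>R iexp (- (2 * pi) * (x * s)) =
        complex_of_real (exp (- pi * x\<^sup>2)) * chi (x * s)"
        using c(1) by (simp add: scaleR_conv_of_real mult_ac chi_def)
    qed
  qed
  finally show "(LINT t|lborel. complex_of_real (exp (- pi * t\<^sup>2)) * chi (t * s)) 
      = complex_of_real (exp (- pi * s\<^sup>2))" by simp
qed

text \<open>The factor \<open>pi\<close> makes the case \<open>e = 1\<close> its own Fourier
  transform. As \<open>e\<close> tends to 0 the function tends to 1, so it serves as a convergence
  factor.\<close>

definition gauss :: "real \<Rightarrow> 'a::euclidean_space \<Rightarrow> real" where
  "gauss e x = exp (- pi * (e * norm x)\<^sup>2)"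

lemma gauss_nonneg: "0 \<le> gauss e x" and gauss_le_1: "gauss e x \<le> 1"
  by (auto simp: gauss_def)

lemma gauss_measurable [measurable]: "gauss e \<in> borel_measurable borel"
  unfolding gauss_def by measurable

text \<open>Both the Gaussian and the character factor over the coordinates, and
  \<open>lborel\<close> is the image of a product measure (\<open>lborel_eq\<close>). This reduces
  the integral to a product of one-dimensional ones.\<close>

lemma gauss_1_integral:
  fixes \<xi> :: "'a::euclidean_space"
  shows "integrable lborel (gauss 1 :: 'a \<Rightarrow> real)"
    and "(LINT x|lborel. complex_of_real (gauss 1 x) * chi (x \<bullet> \<xi>))
      = complex_of_real (gauss 1 \<xi>)"
proof -
  interpret product_sigma_finite "\<lambda>_::'a. lborel :: real measure" ..
  let ?T = "\<lambda>f::'a\<Rightarrow>real. \<Sum>b\<in>Basis. f b *\<^sub>R b"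
  have g: "gauss 1 x = (\<Prod>b\<in>Basis. exp (- pi * (x \<bullet> b)\<^sup>2))" for x :: 'a
    by (simp add: gauss_def exp_sum[symmetric] sum_negf sum_distrib_left[symmetric] norm_eq_sqrt_inner[of x] euclidean_inner[of x x] power2_eq_square[symmetric] sum_nonneg)
  have T: "?T f \<bullet> b = f b" if "b \<in> Basis" for f b
    using that by (simp add: inner_sum_left inner_Basis if_distrib cong: if_cong)
  have "integrable (Pi\<^sub>M Basis (\<lambda>_. lborel)) (\<lambda>f. \<Prod>b\<in>(Basis :: 'a set). exp (- pi * (f b)\<^sup>2))"
    by (rule product_integrable_prod) (use gauss_integral_real(1) in simp_all)
  then have "integrable (Pi\<^sub>M Basis (\<lambda>_. lborel)) (\<lambda>f. gauss 1 (?T f))"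
    unfolding g by (simp add: T)
  then show "integrable lborel (gauss 1 :: 'a \<Rightarrow> real)"
    unfolding lborel_eq[where 'a='a] by (subst integrable_distr_eq) auto
  let ?h = "\<lambda>(b::'a) t. complex_of_real (exp (- pi * t\<^sup>2)) * chi (t * (\<xi> \<bullet> b))"
  have 1: "integrable lborel (?h b)" for b
    using gauss_integral_real(1) by (rule Bochner_Integration.integrable_bound) (auto simp: norm_mult)
  have "(LINT x|lborel. complex_of_real (gauss 1 x) * chi (x \<bullet> \<xi>))
     = (LINT f|Pi\<^sub>M Basis (\<lambda>_. lborel). (\<Prod>b\<in>Basis. ?h b (f b)))"
    unfolding lborel_eq[where 'a='a]
    by (subst integral_distr) (auto intro!: Bochner_Integration.integral_cong
       simp: g T prod.distrib chi_sum euclidean_inner[of _ \<xi>])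
  also have "\<dots> = (\<Prod>b\<in>Basis. (LINT t|lborel. ?h b t))"
    by (rule product_integral_prod) (use 1 in simp_all)
  also have "\<dots> = complex_of_real (gauss 1 \<xi>)"
    by (simp only: gauss_integral_real(2) g of_real_prod)
  finally show "(LINT x|lborel. complex_of_real (gauss 1 x) * chi (x \<bullet> \<xi>))
      = complex_of_real (gauss 1 \<xi>)" .
qed

section \<open>Integration tools and the Gaussian kernel\<close>

lemma integrable_pair_mult:
  fixes f g :: "_ \<Rightarrow> 'b::{real_normed_field, banach, second_countable_topology}"
  assumes f: "integrable lborel f" and g: "integrable lborel g"
  shows "integrable (lborel \<Otimes>\<^sub>M lborel) (\<lambda>(x, y). f x * g y)"
proof (rule lborel_pair.Fubini_integrable)
  note [measurable] = borel_measurable_integrable[OF f] borel_measurable_integrable[OF g]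
  show "(\<lambda>(x, y). f x * g y) \<in> borel_measurable (lborel \<Otimes>\<^sub>M lborel)"
    by measurable
  show "integrable lborel (\<lambda>x. LINT y|lborel. norm (case (x, y) of (x, y) \<Rightarrow> f x * g y))"
    using f by (simp add: norm_mult)
  show "AE x in lborel. integrable lborel (\<lambda>y. case (x, y) of (x, y) \<Rightarrow> f x * g y)"
    using g by simp
qed

text \<open>A function that is not integrable has Bochner integral 0, so the bound also holds in
  that case.\<close>

lemma ennreal_norm_integral_le:
  fixes f :: "_ \<Rightarrow> 'b::{banach, second_countable_topology}"
  shows "ennreal (norm (integral\<^sup>L M f)) \<le> (\<integral>\<^sup>+x. ennreal (norm (f x)) \<partial>M)"
  by (cases "integrable M f") (auto simp: integral_norm_bound_ennreal not_integrable_integral_eq)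

text \<open>Fatou's lemma, in a form where the bounds may vary along the sequence and only their
  limit survives.\<close>

lemma nn_integral_le_of_tendsto:
  fixes u :: "nat \<Rightarrow> 'a \<Rightarrow> ennreal"
  assumes "\<And>n. u n \<in> borel_measurable M" "\<And>x. (\<lambda>n. u n x) \<longlonglongrightarrow> v x"
    "\<And>n. (\<integral>\<^sup>+x. u n x \<partial>M) \<le> c n" "c \<longlonglongrightarrow> C"
  shows "(\<integral>\<^sup>+x. v x \<partial>M) \<le> C"
proof -
  have "(\<integral>\<^sup>+x. v x \<partial>M) = (\<integral>\<^sup>+x. liminf (\<lambda>n. u n x) \<partial>M)"
    using lim_imp_Liminf[OF sequentially_bot assms(2)] by simp
  also have "\<dots> \<le> liminf (\<lambda>n. \<integral>\<^sup>+x. u n x \<partial>M)"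
    by (rule nn_integral_liminf) fact
  also have "\<dots> \<le> liminf c"
    by (rule Liminf_mono) (simp add: assms(3))
  also have "\<dots> = C"
    using assms(4) by (simp add: lim_imp_Liminf)
  finally show ?thesis .
qed

text \<open>The Fourier transform of \<open>gauss e\<close>: a Gaussian of width \<open>e\<close>
  and total mass 1, hence an approximate identity as \<open>e\<close> tends to 0.\<close>

definition gauss_kernel :: "real \<Rightarrow> 'a::euclidean_space \<Rightarrow> real" where
  "gauss_kernel e x = (1 / e) ^ DIM('a) * gauss (1 / e) x"

lemma gauss_kernel_nonneg: "0 < e \<Longrightarrow> 0 \<le> gauss_kernel e x"
  by (simp add: gauss_kernel_def gauss_nonneg)

lemma gauss_kernel_measurable [measurable]: "gauss_kernel e \<in> borel_measurable borel"
  unfolding gauss_kernel_def by measurable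

lemma gauss_scaleR: "gauss e x = gauss 1 (e *\<^sub>R x)"
  by (simp add: gauss_def power_mult_distrib)

lemma integrable_gauss: "0 < e \<Longrightarrow> integrable lborel (gauss e :: 'a::euclidean_space \<Rightarrow> real)"
  using integrable_lborel_affine_iff[of "gauss 1 :: 'a \<Rightarrow> real" e 0] gauss_1_integral(1)
  by (simp add: gauss_scaleR[of e, abs_def])

text \<open>The self-dual case \<open>e = 1\<close>, evaluated at \<open>\<xi> /\<^sub>R e\<close>,
  followed by the dilation of the integration variable by \<open>e\<close>.\<close>

lemma integral_gauss_chi:
  fixes \<xi> :: "'a::euclidean_space"
  assumes "0 < e"
  shows "(LINT x|lborel. complex_of_real (gauss e x) * chi (x \<bullet> \<xi>)) = complex_of_real (gauss_kernel e \<xi>)"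
proof -
  have "complex_of_real (gauss 1 (\<xi> /\<^sub>R e)) = (LINT x|lborel. complex_of_real (gauss 1 x) * chi (x \<bullet> (\<xi> /\<^sub>R e)))"
    by (simp only: gauss_1_integral(2))
  also have "\<dots> = (\<bar>e\<bar> ^ DIM('a)) *\<^sub>R (LINT x|lborel. complex_of_real (gauss 1 (0 + e *\<^sub>R x)) * chi ((0 + e *\<^sub>R x) \<bullet> (\<xi> /\<^sub>R e)))"
    using assms by (intro integral_lborel_affine) auto
  also have "\<dots> = (e ^ DIM('a)) *\<^sub>R (LINT x|lborel. complex_of_real (gauss e x) * chi (x \<bullet> \<xi>))"
    using assms by (simp add: gauss_scaleR[of e] mult.assoc[symmetric])
  finally show ?thesis
    using assms by (simp add: gauss_kernel_def gauss_scaleR[of "1/e"] scaleR_conv_of_real field_simps)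
qed

lemma gauss_1_integral_eq_1:
  "(LINT x|lborel. gauss 1 (x :: 'a::euclidean_space)) = 1"
proof -
  have "complex_of_real (LINT x|lborel. gauss 1 (x :: 'a)) = (LINT x|lborel. complex_of_real (gauss 1 (x :: 'a)))"
    by simp
  also have "\<dots> = 1"
    using integral_gauss_chi[of 1 "0::'a"] by (simp add: gauss_kernel_def gauss_def)
  finally show ?thesis by (simp only: of_real_eq_1_iff)
qed

text \<open>Mass 1 in either variable of \<open>gauss_kernel e (y - x)\<close>; the estimate in
  \<open>sqnorm_ft_le\<close> integrates over both.\<close>

lemma nn_integral_gauss_kernel:
  assumes "0 < e"
  shows "(\<integral>\<^sup>+x. ennreal (gauss_kernel e (x - t)) \<partial>lborel) = 1"
    and "(\<integral>\<^sup>+x. ennreal (gauss_kernel e (t - x :: 'a::euclidean_space)) \<partial>lborel) = 1"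
proof -
  have "(\<integral>\<^sup>+x. ennreal (gauss_kernel e (x :: 'a)) \<partial>lborel)
      = ennreal (\<bar>e\<bar> ^ DIM('a)) * (\<integral>\<^sup>+x. ennreal (gauss_kernel e (0 + e *\<^sub>R (x :: 'a))) \<partial>lborel)"
    using assms by (intro nn_integral_lborel_affine) auto
  also have "\<dots> = (\<integral>\<^sup>+x. ennreal (gauss 1 (x :: 'a)) \<partial>lborel)"
    using assms by (simp add: nn_integral_cmult[symmetric] ennreal_mult[symmetric] gauss_nonneg gauss_kernel_def
        gauss_scaleR[of "1/e"] power_one_over)
  also have "\<dots> = 1"
    by (subst nn_integral_eq_integral) (auto simp: gauss_1_integral gauss_nonneg gauss_1_integral_eq_1)
  finally have 1: "(\<integral>\<^sup>+x. ennreal (gauss_kernel e (x :: 'a)) \<partial>lborel) = 1" .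
  show "(\<integral>\<^sup>+x. ennreal (gauss_kernel e (x - t)) \<partial>lborel) = 1"
    using 1 nn_integral_lborel_affine[of "\<lambda>x. ennreal (gauss_kernel e x)" 1 "- t"] by simp
  show "(\<integral>\<^sup>+x. ennreal (gauss_kernel e (t - x)) \<partial>lborel) = 1"
    using 1 nn_integral_lborel_affine[of "\<lambda>x. ennreal (gauss_kernel e x)" "-1" t] by simp
qed

lemma cnj_measurable [measurable]: "cnj \<in> borel_measurable borel"
  by (intro borel_measurable_continuous_onI continuous_intros)

section \<open>The Fourier transform\<close>

text \<open>The following are the notions of the statement for \<^const>\<open>lborel\<close> in place of \<^const>\<open>lebesgue\<close>:
  the product measure of two completions is not complete, so Fubini is used on Borel functions only.\<close>

definition ft :: "('a::euclidean_space \<Rightarrow> complex) \<Rightarrow> 'a \<Rightarrow> complex" where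
  "ft f \<xi> = (LINT x|lborel. f x * chi (x \<bullet> \<xi>))"

definition conv :: "('a::euclidean_space \<Rightarrow> complex) \<Rightarrow> ('a \<Rightarrow> complex) \<Rightarrow> 'a \<Rightarrow> complex" where
  "conv f g x = (LINT y|lborel. f y * g (x - y))"

definition sqnorm :: "('a::euclidean_space \<Rightarrow> complex) \<Rightarrow> ennreal" where
  "sqnorm f = (\<integral>\<^sup>+x. ennreal ((cmod (f x))\<^sup>2) \<partial>lborel)"

lemma integrable_mult_chi:
  "integrable lborel f \<Longrightarrow> h \<in> borel_measurable borel \<Longrightarrow> integrable lborel (\<lambda>x. f x * chi (h x))"
  by (rule Bochner_Integration.integrable_bound[where f=f]) (auto simp: norm_mult dest: borel_measurable_integrable)

lemma cmod_ft_le: "cmod (ft f \<xi>) \<le> (LINT x|lborel. cmod (f x))"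
  unfolding ft_def by (rule order_trans[OF integral_norm_bound]) (simp add: norm_mult)

lemma continuous_on_ft:
  assumes f: "integrable lborel f"
  shows "continuous_on UNIV (ft f)"
  unfolding continuous_on_sequentially
proof (intro ballI allI impI, elim conjE)
  note [measurable] = borel_measurable_integrable[OF f]
  fix u and a :: 'a assume u: "u \<longlonglongrightarrow> a"
  have [tendsto_intros]: "(\<lambda>n. chi (x \<bullet> u n)) \<longlonglongrightarrow> chi (x \<bullet> a)" for x
    by (rule continuous_on_tendsto_compose[where f=chi and s=UNIV])
       (auto intro: continuous_on_chi continuous_on_id tendsto_inner u)
  show "(ft f \<circ> u) \<longlonglongrightarrow> ft f a"
    unfolding ft_def comp_def
    by (rule integral_dominated_convergence[where w="\<lambda>x. cmod (f x)"])
       (use f in \<open>auto simp: norm_mult intro!: tendsto_intros\<close>)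
qed

lemma ft_measurable [measurable]: "integrable lborel f \<Longrightarrow> ft f \<in> borel_measurable borel"
  by (intro borel_measurable_continuous_onI continuous_on_ft)

section \<open>Convolution theorem and multiplication formula\<close>

lemma conv_measurable [measurable]:
  assumes [measurable]: "f \<in> borel_measurable borel" "g \<in> borel_measurable borel"
  shows "conv f g \<in> borel_measurable borel"
  unfolding conv_def by measurable

text \<open>By translation invariance the inner integral of the modulus is \<open>cmod (f y)\<close>
  times the L1 norm of \<open>g\<close>, so Fubini applies.\<close>

lemma integrable_conv_pair:
  assumes f: "integrable lborel f" and g: "integrable lborel (g :: 'a::euclidean_space \<Rightarrow> complex)"
  shows "integrable (lborel \<Otimes>\<^sub>M lborel) (\<lambda>(y, x). f y * g (x - y))"
proof (rule lborel_pair.Fubini_integrable)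
  note [measurable] = borel_measurable_integrable[OF f] borel_measurable_integrable[OF g]
  have g': "integrable lborel (\<lambda>x. g (x - y))" for y
    using integrable_lborel_affine_iff[of g 1 "-y"] g by (simp add: add.commute)
  have g'': "(LINT x|lborel. cmod (g (x - y))) = (LINT x|lborel. cmod (g x))" for y
    using integral_lborel_affine[of "\<lambda>x. cmod (g x)" 1 "-y"] by (simp add: add.commute)
  show "(\<lambda>(y, x). f y * g (x - y)) \<in> borel_measurable (lborel \<Otimes>\<^sub>M lborel)"
    by measurable
  show "integrable lborel (\<lambda>y. LINT x|lborel. norm (case (y, x) of (y, x) \<Rightarrow> f y * g (x - y)))"
    using f by (simp add: norm_mult g'')
  show "AE y in lborel. integrable lborel (\<lambda>x. case (y, x) of (y, x) \<Rightarrow> f y * g (x - y))"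
    using g' by simp
qed

lemma integrable_conv:
  assumes "integrable lborel f" "integrable lborel g"
  shows "integrable lborel (conv f g)"
  using lborel_pair.integrable_snd[OF integrable_conv_pair[OF assms]] by (simp add: conv_def[abs_def])

text \<open>After exchanging the integrals, the translation of \<open>x\<close> by \<open>y\<close>
  splits the character into one factor for each function.\<close>

lemma ft_conv:
  assumes f: "integrable lborel f" and g: "integrable lborel (g :: 'a::euclidean_space \<Rightarrow> complex)"
  shows "ft (conv f g) \<xi> = ft f \<xi> * ft g \<xi>"
proof -
  note [measurable] = borel_measurable_integrable[OF f] borel_measurable_integrable[OF g]
  have "integrable (lborel \<Otimes>\<^sub>M lborel) (\<lambda>(y, x). f y * g (x - y) * chi (x \<bullet> \<xi>))"
    by (rule Bochner_Integration.integrable_bound[OF integrable_conv_pair[OF f g]]) (auto simp: norm_mult)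
  from lborel_pair.Fubini_integral[OF this]
  have "ft (conv f g) \<xi> = (LINT y|lborel. LINT x|lborel. f y * g (x - y) * chi (x \<bullet> \<xi>))"
    unfolding ft_def conv_def by simp
  also have "\<dots> = (LINT y|lborel. f y * chi (y \<bullet> \<xi>) * ft g \<xi>)"
  proof (intro Bochner_Integration.integral_cong refl)
    fix y
    have "(LINT x|lborel. f y * g (x - y) * chi (x \<bullet> \<xi>)) = (LINT x|lborel. f y * g (y + 1 *\<^sub>R x - y) * chi ((y + 1 *\<^sub>R x) \<bullet> \<xi>))"
      by (subst integral_lborel_affine[of _ 1 y]) auto
    also have "\<dots> = (LINT x|lborel. f y * chi (y \<bullet> \<xi>) * (g x * chi (x \<bullet> \<xi>)))"
      by (simp add: inner_add_left chi_add mult_ac)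
    finally show "(LINT x|lborel. f y * g (x - y) * chi (x \<bullet> \<xi>)) = f y * chi (y \<bullet> \<xi>) * ft g \<xi>"
      by (simp add: ft_def)
  qed
  finally show ?thesis by (simp add: ft_def)
qed

text \<open>Both sides are iterated integrals of
  \<open>f x * k \<xi> * chi (x \<bullet> \<xi>)\<close>, taken in opposite orders.\<close>

lemma integral_ft_mult:
  assumes f: "integrable lborel f" and k: "integrable lborel (k :: 'a::euclidean_space \<Rightarrow> complex)"
  shows "(LINT \<xi>|lborel. ft f \<xi> * k \<xi>) = (LINT x|lborel. f x * ft k x)"
proof -
  note [measurable] = borel_measurable_integrable[OF f] borel_measurable_integrable[OF k]
  have "integrable (lborel \<Otimes>\<^sub>M lborel) (\<lambda>(x, \<xi>). f x * k \<xi> * chi (x \<bullet> \<xi>))"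
    by (rule Bochner_Integration.integrable_bound[OF integrable_pair_mult[OF f k]]) (auto simp: norm_mult)
  from lborel_pair.Fubini_integral[OF this] 
  have "(LINT \<xi>|lborel. LINT x|lborel. f x * k \<xi> * chi (x \<bullet> \<xi>)) = (LINT x|lborel. LINT \<xi>|lborel. f x * k \<xi> * chi (x \<bullet> \<xi>))" .
  moreover have "(LINT x|lborel. f x * k \<xi> * chi (x \<bullet> \<xi>)) = ft f \<xi> * k \<xi>" for \<xi>
    unfolding ft_def by (subst integral_mult_left_zero[symmetric]) (simp add: mult_ac)
  moreover have "(LINT \<xi>|lborel. f x * k \<xi> * chi (x \<bullet> \<xi>)) = f x * ft k x" for x
    unfolding ft_def by (subst integral_mult_right_zero[symmetric]) (simp add: mult_ac inner_commute)
  ultimately show ?thesis by simp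
qed

text \<open>The multiplication formula for a modulated Gaussian, whose transform is the Gaussian
  kernel centred at \<open>x\<close>. As \<open>e\<close> tends to 0, the left side approaches the
  inversion integral and the right side approaches \<open>f x\<close>, under the assumptions of
  \<open>fourier_inversion\<close>.\<close>

lemma gauss_regularisation:
  assumes f: "integrable lborel f" and e: "0 < e"
  shows "(LINT \<xi>|lborel. ft f \<xi> * (complex_of_real (gauss e \<xi>) * chi (- (\<xi> \<bullet> x)))) = (LINT y|lborel. f y * complex_of_real (gauss_kernel e (y - x)))"
proof -
  have "ft (\<lambda>\<xi>. complex_of_real (gauss e \<xi>) * chi (- (\<xi> \<bullet> x))) y = complex_of_real (gauss_kernel e (y - x))" for y
    unfolding ft_def integral_gauss_chi[OF e, symmetric]
    by (simp add: chi_add[symmetric] mult.assoc inner_diff_right algebra_simps)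
  then show ?thesis
    using e by (subst integral_ft_mult[OF f]) (auto intro!: integrable_mult_chi integrable_of_real integrable_gauss)
qed

section \<open>The two Plancherel inequalities and Fourier inversion\<close>

lemma inverse_Suc_tendsto_0: "(\<lambda>n. 1 / real (Suc n)) \<longlonglongrightarrow> 0"
  using LIMSEQ_Suc[OF lim_1_over_n[where 'a=real]] by simp

lemma gauss_tendsto_1: "(\<lambda>n. gauss (1 / Suc n) x) \<longlonglongrightarrow> 1"
proof -
  have "(\<lambda>n. exp (- pi * (1 / Suc n * norm x)\<^sup>2)) \<longlonglongrightarrow> exp (- pi * (0 * norm x)\<^sup>2)"
    by (intro tendsto_intros inverse_Suc_tendsto_0)
  then show ?thesis by (simp add: gauss_def)
qed

text \<open>With the weight \<open>gauss e\<close>, the multiplication formula turns the energy of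
  \<open>ft f\<close> into a double integral of \<open>f x\<close>, the conjugate of
  \<open>f y\<close> and the kernel. Since \<open>2 * s * t \<le> s\<^sup>2 + t\<^sup>2\<close> and
  the kernel has mass 1 in each variable, this is at most \<open>sqnorm f\<close>. Fatou's lemma
  removes the weight.\<close>

lemma sqnorm_ft_le:
  fixes f :: "'a::euclidean_space \<Rightarrow> complex"
  assumes f: "integrable lborel f"
  shows "sqnorm (ft f) \<le> sqnorm f"
proof -
  note [measurable] = borel_measurable_integrable[OF f]
  note [measurable] = ft_measurable[OF f]
  have "(\<integral>\<^sup>+\<xi>. ennreal ((cmod (ft f \<xi>))\<^sup>2 * gauss e \<xi>) \<partial>lborel) \<le> sqnorm f" if e: "0 < e" for e
  proof -
    define B where "B = (LINT x|lborel. cmod (f x))"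
    have B: "cmod (ft f \<xi>) \<le> B" for \<xi> by (simp add: B_def cmod_ft_le)
    \<comment> \<open>The transform is bounded, so the Gaussian weight makes its conjugate an
      admissible second function in \<open>integral_ft_mult\<close>.\<close>
    have 1: "integrable lborel (\<lambda>\<xi>. cnj (ft f \<xi>) * complex_of_real (gauss e \<xi>))"
      by (rule Bochner_Integration.integrable_bound[OF integrable_mult_right[OF integrable_gauss[OF e], of B]])
         (auto simp: norm_mult gauss_nonneg intro!: mult_right_mono order_trans[OF _ abs_ge_self] B)
    have 2: "integrable lborel (\<lambda>\<xi>. (cmod (ft f \<xi>))\<^sup>2 * gauss e \<xi>)"
      by (rule Bochner_Integration.integrable_bound[OF integrable_mult_right[OF integrable_gauss[OF e], of "B\<^sup>2"]])
         (auto simp: norm_mult gauss_nonneg intro!: mult_right_mono power_mono B)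
    have 3: "ft (\<lambda>\<xi>. cnj (ft f \<xi>) * complex_of_real (gauss e \<xi>)) x = cnj (LINT y|lborel. f y * complex_of_real (gauss_kernel e (y - x)))" for x
      unfolding gauss_regularisation[OF f e, symmetric] ft_def[of "\<lambda>\<xi>. cnj (ft f \<xi>) * complex_of_real (gauss e \<xi>)"]
      by (subst Bochner_Integration.integral_cnj[symmetric]) (simp add: cnj_chi mult.assoc)
    have "complex_of_real (LINT \<xi>|lborel. (cmod (ft f \<xi>))\<^sup>2 * gauss e \<xi>) =
        (LINT \<xi>|lborel. ft f \<xi> * (cnj (ft f \<xi>) * complex_of_real (gauss e \<xi>)))"
      by (subst integral_complex_of_real[symmetric]) (simp add: complex_norm_square mult_ac del: integral_complex_of_real of_real_power)
    also have "\<dots> = (LINT x|lborel. f x * cnj (LINT y|lborel. f y * complex_of_real (gauss_kernel e (y - x))))"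
      using integral_ft_mult[OF f 1] by (simp add: 3)
    finally have 4: "complex_of_real (LINT \<xi>|lborel. (cmod (ft f \<xi>))\<^sup>2 * gauss e \<xi>) = \<dots>" .
    have "(\<integral>\<^sup>+\<xi>. ennreal ((cmod (ft f \<xi>))\<^sup>2 * gauss e \<xi>) \<partial>lborel) = ennreal (LINT \<xi>|lborel. (cmod (ft f \<xi>))\<^sup>2 * gauss e \<xi>)"
      by (rule nn_integral_eq_integral[OF 2]) (auto simp: gauss_nonneg)
    also have "\<dots> = ennreal (cmod (LINT x|lborel. f x * cnj (LINT y|lborel. f y * complex_of_real (gauss_kernel e (y - x)))))"
      unfolding 4[symmetric] norm_of_real by (subst abs_of_nonneg) (auto simp: gauss_nonneg intro!: integral_nonneg_AE)
    also have "\<dots> \<le> (\<integral>\<^sup>+x. ennreal (cmod (f x)) * ennreal (cmod (LINT y|lborel. f y * complex_of_real (gauss_kernel e (y - x)))) \<partial>lborel)"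
      by (rule order_trans[OF ennreal_norm_integral_le]) (simp add: norm_mult ennreal_mult)
    also have "\<dots> \<le> (\<integral>\<^sup>+x. ennreal (cmod (f x)) * (\<integral>\<^sup>+y. ennreal (cmod (f y) * gauss_kernel e (y - x)) \<partial>lborel) \<partial>lborel)"
      by (intro nn_integral_mono mult_left_mono order_trans[OF ennreal_norm_integral_le])
         (auto simp: norm_mult gauss_kernel_nonneg[OF e])
    also have "\<dots> = (\<integral>\<^sup>+x. \<integral>\<^sup>+y. ennreal (cmod (f x) * cmod (f y) * gauss_kernel e (y - x)) \<partial>lborel \<partial>lborel)"
      by (simp add: nn_integral_cmult[symmetric] ennreal_mult[symmetric] gauss_kernel_nonneg[OF e] mult.assoc)
    also have "\<dots> \<le> (\<integral>\<^sup>+x. \<integral>\<^sup>+y. (ennreal ((cmod (f x))\<^sup>2 / 2) * ennreal (gauss_kernel e (y - x)) +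
        ennreal ((cmod (f y))\<^sup>2 / 2) * ennreal (gauss_kernel e (y - x))) \<partial>lborel \<partial>lborel)"
    proof (intro nn_integral_mono)
      fix x y :: 'a
      have "cmod (f x) * cmod (f y) \<le> ((cmod (f x))\<^sup>2 + (cmod (f y))\<^sup>2) / 2"
        using sum_squares_bound[of "cmod (f x)" "cmod (f y)"] by simp
      from mult_right_mono[OF this gauss_kernel_nonneg[OF e, of "y - x"]]
      show "ennreal (cmod (f x) * cmod (f y) * gauss_kernel e (y - x)) \<le> ennreal ((cmod (f x))\<^sup>2 / 2) * ennreal (gauss_kernel e (y - x)) +
        ennreal ((cmod (f y))\<^sup>2 / 2) * ennreal (gauss_kernel e (y - x))"
        by (auto simp: ennreal_mult[symmetric] gauss_kernel_nonneg[OF e] ennreal_plus[symmetric] field_simps simp del: ennreal_plus intro!: ennreal_leI)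
    qed
    also have "\<dots> = (\<integral>\<^sup>+x. \<integral>\<^sup>+y. ennreal ((cmod (f x))\<^sup>2 / 2) * ennreal (gauss_kernel e (y - x)) \<partial>lborel \<partial>lborel) +
       (\<integral>\<^sup>+x. \<integral>\<^sup>+y. ennreal ((cmod (f y))\<^sup>2 / 2) * ennreal (gauss_kernel e (y - x)) \<partial>lborel \<partial>lborel)"
      by (simp add: nn_integral_add)
    \<comment> \<open>In this summand the energy factor depends on \<open>y\<close>, so the order is
      exchanged to integrate the kernel over \<open>x\<close> first.\<close>
    also have "(\<integral>\<^sup>+x. \<integral>\<^sup>+y. ennreal ((cmod (f y))\<^sup>2 / 2) * ennreal (gauss_kernel e (y - x)) \<partial>lborel \<partial>lborel) =
       (\<integral>\<^sup>+y. \<integral>\<^sup>+x. ennreal ((cmod (f y))\<^sup>2 / 2) * ennreal (gauss_kernel e (y - x)) \<partial>lborel \<partial>lborel)"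
      by (rule lborel_pair.Fubini') simp
    also have "(\<integral>\<^sup>+x. \<integral>\<^sup>+y. ennreal ((cmod (f x))\<^sup>2 / 2) * ennreal (gauss_kernel e (y - x)) \<partial>lborel \<partial>lborel) +
       (\<integral>\<^sup>+y. \<integral>\<^sup>+x. ennreal ((cmod (f y))\<^sup>2 / 2) * ennreal (gauss_kernel e (y - x)) \<partial>lborel \<partial>lborel) =
       (\<integral>\<^sup>+x. ennreal ((cmod (f x))\<^sup>2 / 2) \<partial>lborel) + (\<integral>\<^sup>+x. ennreal ((cmod (f x))\<^sup>2 / 2) \<partial>lborel)"
      by (simp add: nn_integral_cmult nn_integral_gauss_kernel[OF e])
    also have "\<dots> = sqnorm f"
      by (simp add: nn_integral_add[symmetric] sqnorm_def ennreal_plus[symmetric] del: ennreal_plus)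
    finally show ?thesis .
  qed
  note le = this
  show ?thesis
    unfolding sqnorm_def[of "ft f"]
  proof (rule nn_integral_le_of_tendsto[where u="\<lambda>n \<xi>. ennreal ((cmod (ft f \<xi>))\<^sup>2 * gauss (1 / Suc n) \<xi>)" and c="\<lambda>_. sqnorm f"])
    have "(\<lambda>n. ennreal ((cmod (ft f \<xi>))\<^sup>2 * gauss (1 / Suc n) \<xi>)) \<longlonglongrightarrow> ennreal ((cmod (ft f \<xi>))\<^sup>2 * 1)" for \<xi>
      by (intro tendsto_ennrealI tendsto_mult_left gauss_tendsto_1)
    then show "(\<lambda>n. ennreal ((cmod (ft f \<xi>))\<^sup>2 * gauss (1 / Suc n) \<xi>)) \<longlonglongrightarrow> ennreal ((cmod (ft f \<xi>))\<^sup>2)" for \<xi>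
      by simp
  qed (simp_all add: le)
qed

text \<open>The working class of signals: pointwise inversion is available once the transform is
  integrable, the class is stable under convolution with integrable functions and under the modulus,
  and it is dense in the square integrable functions (\<open>nice_approx\<close>).\<close>

definition nice :: "('a::euclidean_space \<Rightarrow> complex) \<Rightarrow> bool" where
  "nice f \<longleftrightarrow> continuous_on UNIV f \<and> bounded (range f) \<and> integrable lborel f"

lemma nice_measurable: "nice f \<Longrightarrow> f \<in> borel_measurable borel"
  by (auto simp: nice_def intro: borel_measurable_continuous_onI)

lemma nice_integrable: "nice f \<Longrightarrow> integrable lborel f"
  by (simp add: nice_def)

text \<open>Substituting \<open>y = x + e *\<^sub>R z\<close> moves the parameter from the kernel
  into the argument of \<open>h\<close>. Continuity of \<open>h\<close> gives the pointwise limit,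
  and its bound times \<open>gauss 1\<close> dominates.\<close>

lemma gauss_kernel_approximate_identity:
  assumes h: "continuous_on UNIV h" "bounded (range h)"
  shows "(\<lambda>n. LINT y|lborel. h y * complex_of_real (gauss_kernel (1 / Suc n) (y - x :: 'a::euclidean_space))) \<longlonglongrightarrow> h x"
proof -
  obtain B where B: "cmod (h y) \<le> B" for y
    using h(2) by (auto simp: bounded_iff)
  have [measurable]: "h \<in> borel_measurable borel" by (intro borel_measurable_continuous_onI h)
  have eq: "(LINT y|lborel. h y * complex_of_real (gauss_kernel e (y - x))) = (LINT z|lborel. h (x + e *\<^sub>R z) * complex_of_real (gauss 1 z))"
    if "e > 0" for e
  proof -
    have "(LINT y|lborel. h y * complex_of_real (gauss_kernel e (y - x))) =
       \<bar>e\<bar> ^ DIM('a) *\<^sub>R (LINT z|lborel. h (x + e *\<^sub>R z) * complex_of_real (gauss_kernel e (x + e *\<^sub>R z - x)))"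
      using that by (intro integral_lborel_affine) auto
    also have "\<dots> = (LINT z|lborel. h (x + e *\<^sub>R z) * complex_of_real (gauss 1 z))"
      unfolding integral_scaleR_right[symmetric]
      using that by (intro Bochner_Integration.integral_cong refl)
        (simp add: gauss_kernel_def gauss_scaleR[of "1/e"] scaleR_conv_of_real power_one_over)
    finally show ?thesis .
  qed
  have "(\<lambda>n. LINT z|lborel. h (x + (1 / Suc n) *\<^sub>R z) * complex_of_real (gauss 1 z)) \<longlonglongrightarrow> (LINT z::'a|lborel. h x * complex_of_real (gauss 1 z))"
  proof (rule integral_dominated_convergence[where w="\<lambda>z::'a. B * gauss 1 z"])
    have "(\<lambda>n. h (x + (1 / Suc n) *\<^sub>R z)) \<longlonglongrightarrow> h x" for z
    proof (rule continuous_on_tendsto_compose[OF h(1)])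
      have "(\<lambda>n. x + (1 / Suc n) *\<^sub>R z) \<longlonglongrightarrow> x + 0 *\<^sub>R z"
        by (intro tendsto_intros inverse_Suc_tendsto_0)
      then show "(\<lambda>n. x + (1 / Suc n) *\<^sub>R z) \<longlonglongrightarrow> x" by simp
    qed auto
    then show "AE z in lborel. (\<lambda>n. h (x + (1 / Suc n) *\<^sub>R z) * complex_of_real (gauss 1 z)) \<longlonglongrightarrow> h x * complex_of_real (gauss 1 z)"
      by (auto intro!: tendsto_intros)
  qed (auto simp: norm_mult gauss_nonneg gauss_1_integral intro!: mult_right_mono B)
  also have "(LINT z::'a|lborel. h x * complex_of_real (gauss 1 z)) = h x"
    by (simp add: gauss_1_integral_eq_1)
  finally show ?thesis by (simp add: eq)
qed

text \<open>The two sides of \<open>gauss_regularisation\<close> have these limits: one by dominated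
  convergence with \<open>cmod (ft f \<xi>)\<close> as bound, the other by the approximate
  identity.\<close>

lemma fourier_inversion:
  assumes f: "nice f" and ft: "integrable lborel (ft f)"
  shows "ft (ft f) (- x) = f x"
proof (rule LIMSEQ_unique)
  note [measurable] = borel_measurable_integrable[OF ft]
  show "(\<lambda>n. LINT y|lborel. f y * complex_of_real (gauss_kernel (1 / Suc n) (y - x))) \<longlonglongrightarrow> f x"
    using f by (intro gauss_kernel_approximate_identity) (auto simp: nice_def)
  have "(\<lambda>n. LINT \<xi>|lborel. ft f \<xi> * (complex_of_real (gauss (1 / Suc n) \<xi>) * chi (- (\<xi> \<bullet> x)))) \<longlonglongrightarrow> (LINT \<xi>|lborel. ft f \<xi> * chi (- (\<xi> \<bullet> x)))"
  proof (rule integral_dominated_convergence[where w="\<lambda>\<xi>. cmod (ft f \<xi>)"])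
    have "(\<lambda>n. ft f \<xi> * (complex_of_real (gauss (1 / Suc n) \<xi>) * chi (- (\<xi> \<bullet> x)))) \<longlonglongrightarrow> ft f \<xi> * (complex_of_real 1 * chi (- (\<xi> \<bullet> x)))" for \<xi>
      by (intro tendsto_intros gauss_tendsto_1)
    then show "AE \<xi> in lborel. (\<lambda>n. ft f \<xi> * (complex_of_real (gauss (1 / Suc n) \<xi>) * chi (- (\<xi> \<bullet> x)))) \<longlonglongrightarrow> ft f \<xi> * chi (- (\<xi> \<bullet> x))"
      by simp
    show "AE \<xi> in lborel. cmod (ft f \<xi> * (complex_of_real (gauss (1 / Suc n) \<xi>) * chi (- (\<xi> \<bullet> x)))) \<le> cmod (ft f \<xi>)" for n
      by (auto simp: norm_mult gauss_nonneg gauss_le_1 mult_left_le)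
  qed (use ft in auto)
  then show "(\<lambda>n. LINT y|lborel. f y * complex_of_real (gauss_kernel (1 / Suc n) (y - x))) \<longlonglongrightarrow> ft (ft f) (- x)"
    using gauss_regularisation[OF nice_integrable[OF f]] by (simp add: ft_def[of "ft f"])
qed

lemma sqnorm_reflect: "f \<in> borel_measurable borel \<Longrightarrow> sqnorm (\<lambda>x. f (- x)) = sqnorm f"
  unfolding sqnorm_def using nn_integral_lborel_affine[of "\<lambda>x. ennreal ((cmod (f x))\<^sup>2)" "-1" 0] by simp

text \<open>By inversion \<open>f\<close> is the reflected transform of \<open>ft f\<close>, so the
  first Plancherel inequality applies to \<open>ft f\<close>.\<close>

lemma sqnorm_le_sqnorm_ft:
  assumes f: "nice f" and ft: "integrable lborel (ft f)"
  shows "sqnorm f \<le> sqnorm (ft f)"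
proof -
  have "sqnorm f = sqnorm (\<lambda>x. ft (ft f) (- x))"
    by (simp add: fourier_inversion[OF assms])
  also have "\<dots> = sqnorm (ft (ft f))"
    by (intro sqnorm_reflect ft_measurable ft)
  also have "\<dots> \<le> sqnorm (ft f)"
    by (rule sqnorm_ft_le[OF ft])
  finally show ?thesis .
qed

section \<open>Convolution with band-limited functions\<close>

lemma conv_commute:
  assumes [measurable]: "f \<in> borel_measurable borel" "g \<in> borel_measurable borel"
  shows "conv f g x = conv g f (x :: 'a::euclidean_space)"
  using integral_lborel_affine[of "\<lambda>y. f y * g (x - y)" "-1" x] by (simp add: conv_def mult.commute)

text \<open>After commuting, the moving point occurs in the continuous bounded factor, and
  \<open>cmod (g y) * B\<close> dominates.\<close>

lemma nice_conv:
  assumes f: "nice f" and g: "integrable lborel (g :: 'a::euclidean_space \<Rightarrow> complex)"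
  shows "nice (conv f g)"
proof -
  note [measurable] = nice_measurable[OF f] borel_measurable_integrable[OF g]
  have cf: "continuous_on UNIV f" using f by (simp add: nice_def)
  obtain B where B: "cmod (f y) \<le> B" for y
    using f by (auto simp: bounded_iff nice_def)
  have eq: "conv f g = (\<lambda>x. LINT y|lborel. g y * f (x - y))"
    by (rule ext, subst conv_commute) (auto simp: conv_def)
  have "continuous_on UNIV (conv f g)"
    unfolding continuous_on_sequentially
  proof (intro ballI allI impI, elim conjE)
    fix u and a :: 'a assume u: "u \<longlonglongrightarrow> a"
    have "(\<lambda>n. f (u n - y)) \<longlonglongrightarrow> f (a - y)" for y
      by (rule continuous_on_tendsto_compose[OF cf]) (auto intro!: tendsto_intros u)
    then show "(conv f g \<circ> u) \<longlonglongrightarrow> conv f g a"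
      unfolding eq comp_def
      by (intro integral_dominated_convergence[where w="\<lambda>x. cmod (g x) * B"])
         (use g B in \<open>auto simp: norm_mult intro!: tendsto_intros mult_left_mono\<close>)
  qed
  moreover have "cmod (conv f g x) \<le> (LINT y|lborel. cmod (g y) * B)" for x
    unfolding eq
  proof (rule order_trans[OF integral_norm_bound integral_mono])
    show "integrable lborel (\<lambda>y. cmod (g y * f (x - y)))"
      by (rule Bochner_Integration.integrable_bound[where f="\<lambda>x. cmod (g x) * B"])
         (use g B in \<open>auto simp: norm_mult intro!: mult_left_mono order_trans[OF _ abs_ge_self]\<close>)
  qed (use g B in \<open>auto simp: norm_mult intro!: mult_left_mono\<close>)
  then have "bounded (range (conv f g))"
    by (auto simp: bounded_iff)
  ultimately show ?thesis
    using f g by (auto simp: nice_def intro: integrable_conv)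
qed

text \<open>Convolution with such a filter has a continuous transform of compact support. It is
  therefore integrable, as \<open>sqnorm_le_sqnorm_ft\<close> demands.\<close>

definition band_limited :: "('a::euclidean_space \<Rightarrow> complex) \<Rightarrow> bool" where
  "band_limited g \<longleftrightarrow> (\<exists>C. compact C \<and> (\<forall>\<xi>. \<xi> \<notin> C \<longrightarrow> ft g \<xi> = 0))"

lemma integrable_continuous_compact_support:
  fixes f :: "'a::euclidean_space \<Rightarrow> complex"
  assumes "continuous_on UNIV f" "compact C" "\<And>x. x \<notin> C \<Longrightarrow> f x = 0"
  shows "integrable lborel f"
proof -
  have "integrable lborel (\<lambda>x. indicator C x *\<^sub>R f x)"
    by (rule borel_integrable_compact) (use assms in \<open>auto intro: continuous_on_subset\<close>)
  also have "(\<lambda>x. indicator C x *\<^sub>R f x) = f"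
    using assms(3) by (auto simp: indicator_def)
  finally show ?thesis .
qed

lemma integrable_ft_conv:
  assumes f: "integrable lborel f" and g: "integrable lborel g" "band_limited g"
  shows "integrable lborel (ft (conv f g))"
proof -
  obtain C where "compact C" "\<And>\<xi>. \<xi> \<notin> C \<Longrightarrow> ft g \<xi> = 0"
    using g by (auto simp: band_limited_def)
  then show ?thesis
    by (intro integrable_continuous_compact_support[of _ C] continuous_on_ft integrable_conv f g)
       (auto simp: ft_conv f g)
qed

lemma sqnorm_conv_le_ft:
  assumes f: "nice f" and g: "integrable lborel g" "band_limited g"
  shows "sqnorm (conv f g) \<le> (\<integral>\<^sup>+\<xi>. ennreal ((cmod (ft f \<xi>))\<^sup>2 * (cmod (ft g \<xi>))\<^sup>2) \<partial>lborel)"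
proof -
  have "sqnorm (conv f g) \<le> sqnorm (ft (conv f g))"
    by (intro sqnorm_le_sqnorm_ft nice_conv integrable_ft_conv f g nice_integrable)
  then show ?thesis
    by (simp add: sqnorm_def ft_conv nice_integrable[OF f] g norm_mult power_mult_distrib)
qed

lemma ft_le_sqnorm_conv:
  assumes f: "integrable lborel f" and g: "integrable lborel g"
  shows "(\<integral>\<^sup>+\<xi>. ennreal ((cmod (ft f \<xi>))\<^sup>2 * (cmod (ft g \<xi>))\<^sup>2) \<partial>lborel) \<le> sqnorm (conv f g)"
  using sqnorm_ft_le[OF integrable_conv[OF f g]]
  by (simp add: sqnorm_def ft_conv f g norm_mult power_mult_distrib)

text \<open>On the Fourier side each filter multiplies the energy density of \<open>f\<close> by
  \<open>(cmod (ft (G i) \<xi>))\<^sup>2\<close>, and these multipliers add up to at most 1.\<close>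

lemma frame_bound_nice:
  assumes f: "nice f" and "finite S" and G: "\<And>i. i \<in> S \<Longrightarrow> integrable lborel (G i)" "\<And>i. i \<in> S \<Longrightarrow> band_limited (G i)"
    and le: "\<And>\<xi>. (\<Sum>i\<in>S. (cmod (ft (G i) \<xi>))\<^sup>2) \<le> 1"
  shows "(\<Sum>i\<in>S. sqnorm (conv f (G i))) \<le> sqnorm f"
proof -
  note [measurable] = ft_measurable[OF nice_integrable[OF f]] ft_measurable[OF G(1)]
  have "(\<Sum>i\<in>S. sqnorm (conv f (G i))) \<le> (\<Sum>i\<in>S. \<integral>\<^sup>+\<xi>. ennreal ((cmod (ft f \<xi>))\<^sup>2 * (cmod (ft (G i) \<xi>))\<^sup>2) \<partial>lborel)"
    by (intro sum_mono sqnorm_conv_le_ft f G)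
  also have "\<dots> = (\<integral>\<^sup>+\<xi>. (\<Sum>i\<in>S. ennreal ((cmod (ft f \<xi>))\<^sup>2 * (cmod (ft (G i) \<xi>))\<^sup>2)) \<partial>lborel)"
    by (rule nn_integral_sum[symmetric]) simp
  also have "\<dots> = (\<integral>\<^sup>+\<xi>. ennreal ((cmod (ft f \<xi>))\<^sup>2 * (\<Sum>i\<in>S. (cmod (ft (G i) \<xi>))\<^sup>2)) \<partial>lborel)"
    by (simp add: sum_ennreal sum_distrib_left)
  also have "\<dots> \<le> sqnorm (ft f)"
    unfolding sqnorm_def by (intro nn_integral_mono ennreal_leI mult_left_le le) simp
  also have "\<dots> \<le> sqnorm f"
    by (intro sqnorm_ft_le nice_integrable f)
  finally show ?thesis .
qed

section \<open>Density in the square integrable functions\<close>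

text \<open>Expanding \<open>0 \<le> (\<eta> * s - t)\<^sup>2 / \<eta>\<close> bounds the mixed
  term. The free \<open>\<eta>\<close> keeps the constant 1 in \<open>frame_bound\<close>: first the
  error \<open>g\<close> vanishes, then \<open>\<eta>\<close> tends to 0.\<close>

lemma sqnorm_add_le:
  assumes [measurable]: "f \<in> borel_measurable borel" "g \<in> borel_measurable borel" and "0 < \<eta>"
  shows "sqnorm (\<lambda>x. f x + g x) \<le> ennreal (1 + \<eta>) * sqnorm f + ennreal (1 + 1 / \<eta>) * sqnorm g"
proof -
  have le: "(cmod (a + b))\<^sup>2 \<le> (1 + \<eta>) * (cmod a)\<^sup>2 + (1 + 1 / \<eta>) * (cmod b)\<^sup>2" for a b
  proof -
    have "0 \<le> (\<eta> * cmod a - cmod b)\<^sup>2 / \<eta>" using assms by simp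
    also have "\<dots> = \<eta> * (cmod a)\<^sup>2 + (cmod b)\<^sup>2 / \<eta> - 2 * cmod a * cmod b"
      using assms by (simp add: power2_eq_square field_simps)
    finally have "(cmod a + cmod b)\<^sup>2 \<le> (1 + \<eta>) * (cmod a)\<^sup>2 + (1 + 1 / \<eta>) * (cmod b)\<^sup>2"
      by (simp add: power2_sum algebra_simps)
    with power_mono[OF norm_triangle_ineq[of a b] norm_ge_zero, of 2] show ?thesis by (rule order_trans)
  qed
  have "sqnorm (\<lambda>x. f x + g x) \<le> (\<integral>\<^sup>+x. (ennreal (1 + \<eta>) * ennreal ((cmod (f x))\<^sup>2) + ennreal (1 + 1 / \<eta>) * ennreal ((cmod (g x))\<^sup>2)) \<partial>lborel)"
    unfolding sqnorm_def using assms
    by (intro nn_integral_mono) (auto simp: ennreal_mult[symmetric] ennreal_plus[symmetric] simp del: ennreal_plus intro!: ennreal_leI le)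
  also have "\<dots> = ennreal (1 + \<eta>) * sqnorm f + ennreal (1 + 1 / \<eta>) * sqnorm g"
    by (simp add: nn_integral_add nn_integral_cmult sqnorm_def)
  finally show ?thesis .
qed

lemma sqnorm_add_le2:
  assumes [measurable]: "f \<in> borel_measurable borel" "g \<in> borel_measurable borel"
  shows "sqnorm (\<lambda>x. f x + g x) \<le> 2 * sqnorm f + 2 * sqnorm g"
  using sqnorm_add_le[OF assms, of 1] by simp

lemma sqnorm_minus_commute: "sqnorm (\<lambda>x. f x - g x) = sqnorm (\<lambda>x. g x - f x)"
  by (simp add: sqnorm_def norm_minus_commute)

lemma sqnorm_diff_finite:
  assumes "f \<in> borel_measurable borel" "g \<in> borel_measurable borel" "sqnorm f < \<infinity>" "sqnorm g < \<infinity>"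
  shows "sqnorm (\<lambda>x. f x - g x) < \<infinity>"
proof -
  have "sqnorm (\<lambda>x. - g x) = sqnorm g" by (simp add: sqnorm_def)
  then have "sqnorm (\<lambda>x. f x + - g x) \<le> 2 * sqnorm f + 2 * sqnorm g"
    using sqnorm_add_le2[of f "\<lambda>x. - g x"] assms by simp
  also have "\<dots> < \<infinity>"
    using assms by (auto simp: ennreal_mult_less_top)
  finally show ?thesis by simp
qed

text \<open>Cauchy-Schwarz together with invariance under \<open>y \<mapsto> x - y\<close>. It makes
  the convolution of two square integrable functions absolutely convergent at every point, with a
  bound uniform in \<open>x\<close>.\<close>

lemma nn_integral_cmod_conv_le:
  assumes [measurable]: "f \<in> borel_measurable borel" "g \<in> borel_measurable borel"
  shows "(\<integral>\<^sup>+y. ennreal (cmod (f y * g (x - y))) \<partial>lborel)\<^sup>2 \<le> sqnorm f * sqnorm g"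
proof -
  have "(\<integral>\<^sup>+y. ennreal (cmod (f y * g (x - y))) \<partial>lborel)\<^sup>2 \<le> sqnorm f * sqnorm (\<lambda>y. g (x - y))"
    using Cauchy_Schwarz_nn_integral[of "\<lambda>y. ennreal (cmod (f y))" lborel "\<lambda>y. ennreal (cmod (g (x - y)))"]
    by (simp add: norm_mult ennreal_mult[symmetric] ennreal_power sqnorm_def)
  also have "sqnorm (\<lambda>y. g (x - y)) = sqnorm g"
    unfolding sqnorm_def using nn_integral_lborel_affine[of "\<lambda>y. ennreal ((cmod (g y))\<^sup>2)" "-1" x] by simp
  finally show ?thesis .
qed

lemma integrable_conv_L2:
  assumes [measurable]: "f \<in> borel_measurable borel" "g \<in> borel_measurable borel" and "sqnorm f < \<infinity>" "sqnorm g < \<infinity>"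
  shows "integrable lborel (\<lambda>y. f y * g (x - y))"
proof (rule integrableI_bounded)
  have "(\<integral>\<^sup>+y. ennreal (cmod (f y * g (x - y))) \<partial>lborel)\<^sup>2 < \<infinity>"
    using nn_integral_cmod_conv_le[of f g x] assms by (auto simp: ennreal_mult_less_top intro: le_less_trans)
  then show "(\<integral>\<^sup>+y. ennreal (cmod (f y * g (x - y))) \<partial>lborel) < \<infinity>"
    by (simp add: power_less_top_ennreal)
qed simp

lemma cmod_conv_le:
  assumes "f \<in> borel_measurable borel" "g \<in> borel_measurable borel"
  shows "ennreal ((cmod (conv f g x))\<^sup>2) \<le> sqnorm f * sqnorm g"
proof -
  have "ennreal ((cmod (conv f g x))\<^sup>2) = (ennreal (cmod (conv f g x)))\<^sup>2"
    by (simp add: ennreal_power)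
  also have "\<dots> \<le> (\<integral>\<^sup>+y. ennreal (cmod (f y * g (x - y))) \<partial>lborel)\<^sup>2"
    unfolding conv_def by (intro power_mono ennreal_norm_integral_le) simp
  also note nn_integral_cmod_conv_le[OF assms]
  finally show ?thesis .
qed

lemma conv_diff:
  assumes "f \<in> borel_measurable borel" "h \<in> borel_measurable borel" "g \<in> borel_measurable borel"
    and "sqnorm f < \<infinity>" "sqnorm h < \<infinity>" "sqnorm g < \<infinity>"
  shows "conv (\<lambda>x. f x - h x) g x = conv f g x - conv h g x"
  unfolding conv_def
  by (subst Bochner_Integration.integral_diff[symmetric]) (use assms in \<open>auto simp: left_diff_distrib intro!: integrable_conv_L2\<close>)

text \<open>By \<open>cmod_conv_le\<close>, convergence in the L2 norm gives convergence of the
  convolutions at every point. Fatou's lemma then applies without passing to subsequences.\<close>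

lemma conv_tendsto:
  assumes [measurable]: "\<And>n. u n \<in> borel_measurable borel" "f \<in> borel_measurable borel" "g \<in> borel_measurable borel"
    and fin: "\<And>n. sqnorm (u n) < \<infinity>" "sqnorm f < \<infinity>" "sqnorm g < \<infinity>"
    and lim: "(\<lambda>n. sqnorm (\<lambda>x. u n x - f x)) \<longlonglongrightarrow> 0"
  shows "(\<lambda>n. conv (u n) g x) \<longlonglongrightarrow> conv f g x"
proof -
  have "(\<lambda>n. sqnorm (\<lambda>x. u n x - f x) * sqnorm g) \<longlonglongrightarrow> 0 * sqnorm g"
    using fin by (intro tendsto_mult_ennreal lim tendsto_const) auto
  then have lim: "(\<lambda>n. sqnorm (\<lambda>x. u n x - f x) * sqnorm g) \<longlonglongrightarrow> ennreal 0"
    by simp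
  have eq: "conv (\<lambda>x. u n x - f x) g x = conv (u n) g x - conv f g x" for n
    using fin by (intro conv_diff) auto
  have "(\<lambda>n. ennreal ((cmod (conv (\<lambda>x. u n x - f x) g x))\<^sup>2)) \<longlonglongrightarrow> ennreal 0"
    by (rule tendsto_sandwich[OF _ _ tendsto_const lim]) (simp_all add: cmod_conv_le)
  then have "(\<lambda>n. (cmod (conv (u n) g x - conv f g x))\<^sup>2) \<longlonglongrightarrow> 0"
    by (subst (asm) tendsto_ennreal_iff) (simp_all only: eq zero_le_power2 eventually_True)
  then have "(\<lambda>n. sqrt ((cmod (conv (u n) g x - conv f g x))\<^sup>2)) \<longlonglongrightarrow> sqrt 0"
    by (rule tendsto_real_sqrt)
  then show ?thesis
    by (simp add: tendsto_norm_zero_iff Lim_null[symmetric])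
qed

section \<open>Approximation by nice functions and the frame bound\<close>

lemma nice_sqnorm_finite:
  assumes "nice f"
  shows "sqnorm f < \<infinity>"
proof -
  note [measurable] = nice_measurable[OF assms]
  obtain B where B: "cmod (f y) \<le> B" for y
    using assms by (auto simp: bounded_iff nice_def)
  have "sqnorm f \<le> (\<integral>\<^sup>+y. ennreal B * ennreal (cmod (f y)) \<partial>lborel)"
    unfolding sqnorm_def using order_trans[OF norm_ge_zero B]
    by (intro nn_integral_mono) (auto simp: ennreal_mult[symmetric] power2_eq_square intro!: ennreal_leI mult_right_mono B)
  also have "\<dots> = ennreal B * (\<integral>\<^sup>+y. ennreal (cmod (f y)) \<partial>lborel)"
    by (rule nn_integral_cmult) simp
  also have "\<dots> < \<infinity>"
    using nice_integrable[OF assms] by (auto simp: integrable_iff_bounded ennreal_mult_less_top)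
  finally show ?thesis .
qed

lemma sqnorm_tendsto_0:
  assumes [measurable]: "\<And>n. u n \<in> borel_measurable borel" "f \<in> borel_measurable borel" "w \<in> borel_measurable borel"
    and le: "\<And>n x. (cmod (u n x - f x))\<^sup>2 \<le> w x" and w: "(\<integral>\<^sup>+x. ennreal (w x) \<partial>lborel) < \<infinity>"
    and lim: "AE x in lborel. (\<lambda>n. u n x) \<longlonglongrightarrow> f x"
  shows "(\<lambda>n. sqnorm (\<lambda>x. u n x - f x)) \<longlonglongrightarrow> 0"
proof -
  have "(\<lambda>n. \<integral>\<^sup>+x. ennreal ((cmod (u n x - f x))\<^sup>2) \<partial>lborel) \<longlonglongrightarrow> (\<integral>\<^sup>+(x::'a). 0 \<partial>lborel)"
  proof (rule nn_integral_dominated_convergence[where w="\<lambda>x. ennreal (w x)"])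
    show "AE x in lborel. (\<lambda>n. ennreal ((cmod (u n x - f x))\<^sup>2)) \<longlonglongrightarrow> 0"
      using lim
    proof eventually_elim
      case (elim x)
      have "(\<lambda>n. ennreal ((cmod (u n x - f x))\<^sup>2)) \<longlonglongrightarrow> ennreal ((cmod (f x - f x))\<^sup>2)"
        by (intro tendsto_intros elim tendsto_ennrealI)
      then show ?case by simp
    qed
  qed (use w in \<open>auto intro!: ennreal_leI le\<close>)
  then show ?thesis by (simp add: sqnorm_def)
qed

text \<open>Measurability supplies continuous functions converging to \<open>f\<close> off a
  negligible set. Clamping their values and cutting off their supports makes them nice and
  dominated, and changes nothing in the limit because \<open>f\<close> obeys the same
  bounds.\<close>

lemma nice_approx_bounded:
  fixes f :: "'a::euclidean_space \<Rightarrow> complex"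
  assumes [measurable]: "f \<in> borel_measurable borel" and k: "0 < k"
    and le: "\<And>x. cmod (f x) \<le> k" and supp: "\<And>x. k < norm x \<Longrightarrow> f x = 0"
  obtains u where "\<And>n. nice (u n)" "(\<lambda>n. sqnorm (\<lambda>x. u n x - f x)) \<longlonglongrightarrow> 0"
proof -
  have "f measurable_on UNIV"
    by (rule lebesgue_measurable_imp_measurable_on) (auto intro: measurable_completion)
  then obtain N g where N: "negligible N" and g: "\<And>n. continuous_on UNIV (g n)" "\<And>x. x \<notin> N \<Longrightarrow> (\<lambda>n. g n x) \<longlonglongrightarrow> f x"
    by (auto simp: measurable_on_def)
  \<comment> \<open>\<open>cut\<close> is 1 on the ball of radius \<open>k\<close> and 0 outside
    radius \<open>k + 1\<close>; \<open>clamp\<close> is the radial retraction onto the disc of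
    radius \<open>k\<close>, written with \<open>max k\<close> to keep the denominator
    positive.\<close>
  define cut where "cut x = max 0 (min 1 (k + 1 - norm x))" for x :: 'a
  define clamp where "clamp z = complex_of_real (k / max k (cmod z)) * z" for z
  define u where "u n x = clamp (g n x) * complex_of_real (cut x)" for n x
  have cl: "continuous_on UNIV clamp"
    unfolding clamp_def using k by (intro continuous_intros) auto
  have cl_le: "cmod (clamp z) \<le> k" for z
    using k by (auto simp: clamp_def norm_mult max_def norm_divide)
  have u_le: "cmod (u n x) \<le> k" for n x
    using mult_mono[OF cl_le[of "g n x"], of "cut x" 1] k by (auto simp: u_def norm_mult cut_def)
  have u0: "u n x = 0" if "x \<notin> cball 0 (k + 1)" for n x
    using that by (simp add: u_def cut_def)
  have u_cont: "continuous_on UNIV (u n)" for n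
    unfolding u_def cut_def by (intro continuous_intros continuous_on_compose2[OF cl] g) auto
  have "integrable lborel (u n)" for n
    by (rule integrable_continuous_compact_support[OF u_cont compact_cball u0])
  then have nice: "nice (u n)" for n
    using u_cont u_le by (auto simp: nice_def bounded_iff intro!: exI[of _ k])
  note [measurable] = nice_measurable[OF nice]
  have "(\<lambda>n. sqnorm (\<lambda>x. u n x - f x)) \<longlonglongrightarrow> 0"
  proof (rule sqnorm_tendsto_0[where w="\<lambda>x. (2 * k)\<^sup>2 * indicator (cball 0 (k + 1)) x"])
    show "(cmod (u n x - f x))\<^sup>2 \<le> (2 * k)\<^sup>2 * indicator (cball 0 (k + 1)) x" for n x
    proof (cases "x \<in> cball 0 (k + 1)")
      case True
      have "cmod (u n x - f x) \<le> k + k"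
        by (rule order_trans[OF norm_triangle_ineq4 add_mono[OF u_le le]])
      from power_mono[OF this norm_ge_zero, of 2] show ?thesis using True by simp
    qed (use u0 supp in auto)
    show "(\<integral>\<^sup>+x. ennreal ((2 * k)\<^sup>2 * indicator (cball 0 (k + 1)) (x :: 'a)) \<partial>lborel) < \<infinity>"
    proof -
      have "(\<integral>\<^sup>+x. ennreal ((2 * k)\<^sup>2 * indicator (cball 0 (k + 1)) (x :: 'a)) \<partial>lborel) = ennreal ((2 * k)\<^sup>2) * emeasure lborel (cball (0 :: 'a) (k + 1))"
        by (subst nn_integral_cmult_indicator[symmetric]) (auto intro!: nn_integral_cong split: split_indicator)
      then show ?thesis
        using emeasure_lborel_cball_finite[of "0 :: 'a" "k + 1"] by (simp add: ennreal_mult_less_top)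
    qed
    have "(\<lambda>n. u n x) \<longlonglongrightarrow> f x" if "x \<notin> N" for x
    proof -
      have "(\<lambda>n. u n x) \<longlonglongrightarrow> clamp (f x) * complex_of_real (cut x)"
        unfolding u_def by (intro tendsto_intros continuous_on_tendsto_compose[OF cl] g that) auto
      also have "clamp (f x) * complex_of_real (cut x) = f x"
      proof (cases "norm x \<le> k")
        case True
        then show ?thesis using k le[of x] by (simp add: clamp_def cut_def)
      next
        case False
        then show ?thesis using supp[of x] by (simp add: clamp_def)
      qed
      finally show ?thesis .
    qed
    moreover have "AE x in lborel. x \<notin> N"
      using AE_not_in[of N lebesgue] N by (simp add: negligible_iff_null_sets AE_completion_iff)
    ultimately show "AE x in lborel. (\<lambda>n. u n x) \<longlonglongrightarrow> f x"
      by auto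
    show "(\<lambda>x. (2 * k)\<^sup>2 * indicator (cball 0 (k + 1)) (x :: 'a)) \<in> borel_measurable borel"
      by (intro borel_measurable_times borel_measurable_const borel_measurable_indicator) simp
  qed auto
  with nice show ?thesis by (rule that)
qed

text \<open>Truncation in both position and size reduces to \<open>nice_approx_bounded\<close>; the
  approximants are then chosen with errors at most \<open>1 / Suc n\<close>.\<close>

lemma nice_approx:
  fixes f :: "'a::euclidean_space \<Rightarrow> complex"
  assumes [measurable]: "f \<in> borel_measurable borel" and fin: "sqnorm f < \<infinity>"
  obtains u where "\<And>n. nice (u n)" "(\<lambda>n. sqnorm (\<lambda>x. u n x - f x)) \<longlonglongrightarrow> 0"
proof -
  define h where "h k x = (if norm x \<le> real k + 1 \<and> cmod (f x) \<le> real k + 1 then f x else 0)" for k x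
  have [measurable]: "h k \<in> borel_measurable borel" for k
    unfolding h_def by measurable
  have h0: "(\<lambda>k. sqnorm (\<lambda>x. h k x - f x)) \<longlonglongrightarrow> 0"
  proof (rule sqnorm_tendsto_0[where w="\<lambda>x. (cmod (f x))\<^sup>2"])
    have "(\<lambda>k. h k x) \<longlonglongrightarrow> f x" for x
    proof (rule tendsto_eventually)
      obtain m where "max (norm x) (cmod (f x)) \<le> real m"
        using real_arch_simple by blast
      then show "\<forall>\<^sub>F k in sequentially. h k x = f x"
        by (intro eventually_sequentiallyI[of m]) (auto simp: h_def)
    qed
    then show "AE x in lborel. (\<lambda>k. h k x) \<longlonglongrightarrow> f x" by simp
  qed (use fin in \<open>auto simp: h_def sqnorm_def\<close>)
  have ex: "\<exists>g. nice g \<and> sqnorm (\<lambda>x. g x - f x) \<le> ennreal e" if e: "0 < e" for e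
  proof -
    \<comment> \<open>Each of the two errors is kept below \<open>e / 4\<close> because
      \<open>sqnorm_add_le2\<close> doubles both.\<close>
    have "eventually (\<lambda>k. sqnorm (\<lambda>x. h k x - f x) < ennreal (e / 4)) sequentially"
      using e by (intro order_tendstoD(2)[OF h0]) simp
    then obtain k where k: "sqnorm (\<lambda>x. h k x - f x) < ennreal (e / 4)"
      by (auto simp: eventually_sequentially)
    obtain u where u: "\<And>n. nice (u n)" "(\<lambda>n. sqnorm (\<lambda>x. u n x - h k x)) \<longlonglongrightarrow> 0"
      by (rule nice_approx_bounded[of "h k" "real k + 1"]) (auto simp: h_def)
    have "eventually (\<lambda>n. sqnorm (\<lambda>x. u n x - h k x) < ennreal (e / 4)) sequentially"
      using e by (intro order_tendstoD(2)[OF u(2)]) simp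
    then obtain n where n: "sqnorm (\<lambda>x. u n x - h k x) < ennreal (e / 4)"
      by (auto simp: eventually_sequentially)
    note [measurable] = nice_measurable[OF u(1)]
    have "sqnorm (\<lambda>x. u n x - f x) \<le> 2 * sqnorm (\<lambda>x. u n x - h k x) + 2 * sqnorm (\<lambda>x. h k x - f x)"
      using sqnorm_add_le2[of "\<lambda>x. u n x - h k x" "\<lambda>x. h k x - f x"] by simp
    also have "\<dots> \<le> 2 * ennreal (e / 4) + 2 * ennreal (e / 4)"
      using n k by (intro add_mono mult_left_mono) auto
    also have "\<dots> = ennreal (2 * (e / 4) + 2 * (e / 4))"
      using e ennreal_mult[of 2 "e / 4"] ennreal_plus[of "2 * (e / 4)" "2 * (e / 4)"] by simp
    also have "\<dots> = ennreal e"
      by simp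
    finally show ?thesis using u(1) by blast
  qed
  have "\<forall>n. \<exists>g. nice g \<and> sqnorm (\<lambda>x. g x - f x) \<le> ennreal (1 / Suc n)"
    by (intro allI ex) simp
  then obtain u where u: "\<And>n. nice (u n)" "\<And>n. sqnorm (\<lambda>x. u n x - f x) \<le> ennreal (1 / Suc n)"
    by metis
  have "(\<lambda>n. ennreal (1 / Suc n)) \<longlonglongrightarrow> ennreal 0"
    by (intro tendsto_ennrealI inverse_Suc_tendsto_0)
  then have lim: "(\<lambda>n. ennreal (1 / Suc n)) \<longlonglongrightarrow> 0"
    by (simp only: ennreal_0)
  have "(\<lambda>n. sqnorm (\<lambda>x. u n x - f x)) \<longlonglongrightarrow> 0"
    by (rule tendsto_sandwich[OF _ _ tendsto_const lim]) (simp_all only: zero_le u(2) eventually_True)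
  with u(1) show ?thesis by (rule that)
qed

text \<open>Nice approximants satisfy the bound, their convolutions converge pointwise, and Fatou's
  lemma passes to the limit. This costs a factor \<open>1 + \<eta>\<close>, which disappears as
  \<open>\<eta>\<close> tends to 0.\<close>

lemma frame_bound:
  assumes [measurable]: "f \<in> borel_measurable borel" and fin: "sqnorm f < \<infinity>" and "finite S"
    and G: "\<And>i. i \<in> S \<Longrightarrow> integrable lborel (G i)" "\<And>i. i \<in> S \<Longrightarrow> band_limited (G i)" "\<And>i. i \<in> S \<Longrightarrow> sqnorm (G i) < \<infinity>"
    and le: "\<And>\<xi>. (\<Sum>i\<in>S. (cmod (ft (G i) \<xi>))\<^sup>2) \<le> 1"
  shows "(\<Sum>i\<in>S. sqnorm (conv f (G i))) \<le> sqnorm f"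
proof -
  obtain u where u: "\<And>n. nice (u n)" "(\<lambda>n. sqnorm (\<lambda>x. u n x - f x)) \<longlonglongrightarrow> 0"
    by (rule nice_approx[OF assms(1,2)]) (rule that)
  note [measurable] = nice_measurable[OF u(1)] borel_measurable_integrable[OF G(1)]
  have eq: "(\<Sum>i\<in>S. sqnorm (conv h (G i))) = (\<integral>\<^sup>+x. (\<Sum>i\<in>S. ennreal ((cmod (conv h (G i) x))\<^sup>2)) \<partial>lborel)"
    if [measurable]: "h \<in> borel_measurable borel" for h
    unfolding sqnorm_def by (rule nn_integral_sum[symmetric]) simp
  have main: "(\<Sum>i\<in>S. sqnorm (conv f (G i))) \<le> ennreal (1 + \<eta>) * sqnorm f" if \<eta>: "0 < \<eta>" for \<eta>
  proof -
    have "(\<integral>\<^sup>+x. (\<Sum>i\<in>S. ennreal ((cmod (conv f (G i) x))\<^sup>2)) \<partial>lborel) \<le> ennreal (1 + \<eta>) * sqnorm f"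
    proof (rule nn_integral_le_of_tendsto)
      show "(\<lambda>x. \<Sum>i\<in>S. ennreal ((cmod (conv (u n) (G i) x))\<^sup>2)) \<in> borel_measurable lborel" for n
        by measurable
      show "(\<lambda>n. \<Sum>i\<in>S. ennreal ((cmod (conv (u n) (G i) x))\<^sup>2)) \<longlonglongrightarrow> (\<Sum>i\<in>S. ennreal ((cmod (conv f (G i) x))\<^sup>2))" for x
        using u fin G nice_sqnorm_finite[OF u(1)] by (intro tendsto_sum tendsto_ennrealI tendsto_power tendsto_norm conv_tendsto) auto
      show "(\<integral>\<^sup>+x. (\<Sum>i\<in>S. ennreal ((cmod (conv (u n) (G i) x))\<^sup>2)) \<partial>lborel) \<le> ennreal (1 + \<eta>) * sqnorm f + ennreal (1 + 1 / \<eta>) * sqnorm (\<lambda>x. u n x - f x)" for n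
      proof -
        have "(\<integral>\<^sup>+x. (\<Sum>i\<in>S. ennreal ((cmod (conv (u n) (G i) x))\<^sup>2)) \<partial>lborel) \<le> sqnorm (u n)"
          using frame_bound_nice[OF u(1) \<open>finite S\<close> G(1,2) le] by (subst eq[symmetric]) auto
        also have "\<dots> \<le> ennreal (1 + \<eta>) * sqnorm f + ennreal (1 + 1 / \<eta>) * sqnorm (\<lambda>x. u n x - f x)"
          using sqnorm_add_le[of f "\<lambda>x. u n x - f x" \<eta>] \<eta> by simp
        finally show ?thesis .
      qed
      have "(\<lambda>n. ennreal (1 + \<eta>) * sqnorm f + ennreal (1 + 1 / \<eta>) * sqnorm (\<lambda>x. u n x - f x)) \<longlonglongrightarrow> ennreal (1 + \<eta>) * sqnorm f + ennreal (1 + 1 / \<eta>) * 0"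
        by (intro tendsto_add tendsto_mult_ennreal tendsto_const u) auto
      then show "(\<lambda>n. ennreal (1 + \<eta>) * sqnorm f + ennreal (1 + 1 / \<eta>) * sqnorm (\<lambda>x. u n x - f x)) \<longlonglongrightarrow> ennreal (1 + \<eta>) * sqnorm f"
        by simp
    qed
    then show ?thesis by (simp add: eq)
  qed
  have "(\<lambda>n. ennreal (1 + 1 / Suc n) * sqnorm f) \<longlonglongrightarrow> ennreal (1 + 0) * sqnorm f"
    using fin by (intro tendsto_mult_ennreal tendsto_ennrealI tendsto_add tendsto_const inverse_Suc_tendsto_0) auto
  then have "(\<lambda>n. ennreal (1 + 1 / Suc n) * sqnorm f) \<longlonglongrightarrow> sqnorm f"
    by simp
  then show ?thesis
    by (rule LIMSEQ_le_const) (intro exI allI impI main, simp)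
qed

section \<open>Energy in the low-pass output\<close>

text \<open>Conjugation reflects the character, and evenness undoes the reflection, so the transform
  is real.\<close>

lemma ft_of_even_real:
  fixes f :: "'a::euclidean_space \<Rightarrow> real"
  assumes [measurable]: "f \<in> borel_measurable borel" and even: "\<And>x. f (- x) = f x"
  shows "ft (\<lambda>x. complex_of_real (f x)) \<xi> = complex_of_real (Re (ft (\<lambda>x. complex_of_real (f x)) \<xi>))"
proof -
  have "cnj (ft (\<lambda>x. complex_of_real (f x)) \<xi>) = (LINT x|lborel. complex_of_real (f x) * chi (- (x \<bullet> \<xi>)))"
    unfolding ft_def by (subst Bochner_Integration.integral_cnj[symmetric]) (simp add: cnj_chi)
  also have "\<dots> = ft (\<lambda>x. complex_of_real (f x)) \<xi>"
    unfolding ft_def by (subst integral_lborel_affine[of _ "-1" 0]) (simp_all add: even)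
  finally show ?thesis
    by (metis Reals_cnj_iff of_real_Re)
qed

text \<open>The filter is \<open>\<phi> = (\<psi>^)\<^sup>2\<close> for a tent function \<open>\<psi>\<close>: it is nonnegative, and its transform is
  \<open>\<psi> * \<psi>\<close> up to reflection.\<close>

lemma low_pass_filter:
  fixes \<delta> :: real
  assumes "0 < \<delta>"
  obtains \<phi> :: "'a::euclidean_space \<Rightarrow> real" and c r :: real
  where "\<And>x. 0 \<le> \<phi> x" "integrable lborel \<phi>" "0 < c" "0 < r"
    "\<And>\<xi>. cmod (ft (\<lambda>x. complex_of_real (\<phi> x)) \<xi>) \<le> 1 / 2"
    "\<And>\<xi>. \<delta> \<le> norm \<xi> \<Longrightarrow> ft (\<lambda>x. complex_of_real (\<phi> x)) \<xi> = 0"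
    "\<And>\<xi>. norm \<xi> < r \<Longrightarrow> c \<le> cmod (ft (\<lambda>x. complex_of_real (\<phi> x)) \<xi>)"
proof -
  \<comment> \<open>The radius \<open>\<delta> / 2\<close> is half the target, since
    self-convolution doubles the support.\<close>
  define \<psi> :: "'a \<Rightarrow> real" where "\<psi> x = max 0 (\<delta> / 2 - norm x)" for x
  let ?\<psi> = "\<lambda>x. complex_of_real (\<psi> x)"
  have \<psi>0: "\<psi> x = 0" if "\<delta> / 2 \<le> norm x" for x
    using that by (simp add: \<psi>_def)
  have \<psi>_cont: "continuous_on UNIV \<psi>"
    unfolding \<psi>_def by (intro continuous_intros)
  have "cmod (?\<psi> x) \<le> \<delta> / 2" for x
    using assms by (simp add: \<psi>_def max_def)
  moreover have "integrable lborel ?\<psi>"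
    by (rule integrable_continuous_compact_support[of _ "cball 0 (\<delta> / 2)"])
       (auto intro!: continuous_intros \<psi>_cont \<psi>0)
  ultimately have nice: "nice ?\<psi>"
    by (auto simp: nice_def bounded_iff intro!: continuous_intros \<psi>_cont exI[of _ "\<delta> / 2"])
  note int = nice_integrable[OF nice]
  have [measurable]: "\<psi> \<in> borel_measurable borel"
    by (intro borel_measurable_continuous_onI \<psi>_cont)
  note [measurable] = ft_measurable[OF int]
  define \<Psi> where "\<Psi> = conv ?\<psi> ?\<psi>"
  have nice\<Psi>: "nice \<Psi>"
    unfolding \<Psi>_def by (rule nice_conv[OF nice int])
  define \<phi>0 where "\<phi>0 \<xi> = (Re (ft ?\<psi> \<xi>))\<^sup>2" for \<xi>
  have ft\<psi>: "ft ?\<psi> \<xi> = complex_of_real (Re (ft ?\<psi> \<xi>))" for \<xi>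
    by (rule ft_of_even_real) (auto simp: \<psi>_def)
  have ft\<Psi>: "ft \<Psi> = (\<lambda>\<xi>. complex_of_real (\<phi>0 \<xi>))"
    unfolding \<Psi>_def \<phi>0_def by (rule ext, subst ft_conv[OF int int]) (subst (1 2) ft\<psi>, simp add: power2_eq_square)
  have [measurable]: "\<phi>0 \<in> borel_measurable borel"
    unfolding \<phi>0_def by measurable
  \<comment> \<open>The integral of \<open>\<phi>0\<close> is the energy of the transform of
    \<open>\<psi>\<close>, finite by the first Plancherel inequality.\<close>
  have "sqnorm (ft ?\<psi>) < \<infinity>"
    by (rule le_less_trans[OF sqnorm_ft_le[OF int] nice_sqnorm_finite[OF nice]])
  also have "sqnorm (ft ?\<psi>) = (\<integral>\<^sup>+\<xi>. ennreal (norm (\<phi>0 \<xi>)) \<partial>lborel)"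
    unfolding sqnorm_def by (subst ft\<psi>) (simp add: \<phi>0_def)
  finally have int\<phi>0: "integrable lborel \<phi>0"
    by (intro integrableI_bounded) simp_all
  have inv: "ft (\<lambda>x. complex_of_real (\<phi>0 x)) \<xi> = \<Psi> (- \<xi>)" for \<xi>
    using fourier_inversion[OF nice\<Psi>, of "- \<xi>"] int\<phi>0 by (simp add: ft\<Psi>)
  have \<Psi>0: "\<Psi> x = 0" if "\<delta> \<le> norm x" for x
  proof -
    have "?\<psi> y * ?\<psi> (x - y) = 0" for y
      using that \<psi>0[of y] \<psi>0[of "x - y"] norm_triangle_ineq2[of x y] by fastforce
    then show ?thesis by (simp only: \<Psi>_def conv_def integral_zero)
  qed
  obtain M where M: "\<And>x. cmod (\<Psi> x) \<le> M" "0 < M"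
    using nice\<Psi> by (auto simp: nice_def bounded_pos)
  \<comment> \<open>As \<open>\<psi>\<close> is even, \<open>\<Psi> 0\<close> is the integral of its
    square, and \<open>\<psi>\<close> is at least \<open>\<delta> / 4\<close> on the ball of radius
    \<open>\<delta> / 4\<close>.\<close>
  have "0 < cmod (\<Psi> 0)"
  proof -
    have "0 < (\<delta> / 4)\<^sup>2 * measure lborel (ball 0 (\<delta> / 4) :: 'a set)"
      using assms content_ball_pos[of "\<delta> / 4" "0 :: 'a"] by simp
    also have "\<dots> = (LINT y|lborel. (\<delta> / 4)\<^sup>2 * indicator (ball 0 (\<delta> / 4)) (y :: 'a))"
      by simp
    also have "\<dots> \<le> (LINT y|lborel. (\<psi> y)\<^sup>2)"
    proof (rule integral_mono)
      show "integrable lborel (\<lambda>y. (\<delta> / 4)\<^sup>2 * indicator (ball 0 (\<delta> / 4)) (y :: 'a))"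
        using emeasure_lborel_ball_finite[of "0 :: 'a" "\<delta> / 4"] by (intro integrable_mult_right integrable_real_indicator) auto
      show "integrable lborel (\<lambda>y. (\<psi> y)\<^sup>2)"
        using nice_sqnorm_finite[OF nice] by (intro integrableI_bounded) (auto simp: sqnorm_def)
      show "(\<delta> / 4)\<^sup>2 * indicator (ball 0 (\<delta> / 4)) y \<le> (\<psi> y)\<^sup>2" for y :: 'a
        using assms by (auto simp: \<psi>_def indicator_def intro!: power_mono)
    qed
    finally have pos: "0 < (LINT y|lborel. (\<psi> y)\<^sup>2)" .
    have "\<Psi> 0 = (LINT y|lborel. complex_of_real ((\<psi> y)\<^sup>2))"
      unfolding \<Psi>_def conv_def by (intro Bochner_Integration.integral_cong refl) (simp add: power2_eq_square \<psi>_def)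
    also have "\<dots> = complex_of_real (LINT y|lborel. (\<psi> y)\<^sup>2)"
      by (rule integral_complex_of_real)
    finally show ?thesis using pos by simp
  qed
  have "isCont \<Psi> 0"
    using nice\<Psi> by (simp add: nice_def continuous_on_eq_continuous_at)
  then obtain r where r: "0 < r" "\<And>x. norm x < r \<Longrightarrow> dist (\<Psi> x) (\<Psi> 0) < cmod (\<Psi> 0) / 2"
    using \<open>0 < cmod (\<Psi> 0)\<close> unfolding continuous_at_eps_delta
    by (metis dist_0_norm dist_commute half_gt_zero)
  have low: "cmod (\<Psi> 0) / 2 \<le> cmod (\<Psi> x)" if "norm x < r" for x
    using r(2)[OF that] norm_triangle_ineq2[of "\<Psi> 0" "\<Psi> x"] by (simp add: dist_norm norm_minus_commute)
  \<comment> \<open>Division by \<open>2 * M\<close> bounds the transform by 1/2, the level that the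
    transform of the low-pass filter \<open>f0\<close> attains on the ball of radius
    \<open>\<delta>\<close> in the application.\<close>
  define \<phi> where "\<phi> x = \<phi>0 x / (2 * M)" for x
  have ft\<phi>: "ft (\<lambda>x. complex_of_real (\<phi> x)) \<xi> = \<Psi> (- \<xi>) / (2 * complex_of_real M)" for \<xi>
    unfolding inv[symmetric] ft_def \<phi>_def by (subst integral_divide_zero[symmetric]) simp
  show ?thesis
  proof (rule that[of \<phi> "cmod (\<Psi> 0) / 2 / (2 * M)" r])
    show "0 \<le> \<phi> x" for x using M by (simp add: \<phi>_def \<phi>0_def)
    show "integrable lborel \<phi>" using int\<phi>0 by (simp add: \<phi>_def[abs_def])
    show "0 < cmod (\<Psi> 0) / 2 / (2 * M)" using M \<open>0 < cmod (\<Psi> 0)\<close> by simp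
    show "cmod (ft (\<lambda>x. complex_of_real (\<phi> x)) \<xi>) \<le> 1 / 2" for \<xi>
      using M(1)[of "- \<xi>"] M(2) by (simp add: ft\<phi> norm_divide norm_mult field_simps)
    show "ft (\<lambda>x. complex_of_real (\<phi> x)) \<xi> = 0" if "\<delta> \<le> norm \<xi>" for \<xi>
      using \<Psi>0[of "- \<xi>"] that by (simp add: ft\<phi>)
    show "cmod (\<Psi> 0) / 2 / (2 * M) \<le> cmod (ft (\<lambda>x. complex_of_real (\<phi> x)) \<xi>)" if "norm \<xi> < r" for \<xi>
      using divide_right_mono[OF low[of "- \<xi>"], of "2 * M"] M(2) that by (simp add: ft\<phi> norm_divide norm_mult)
  qed (rule r(1))
qed

lemma nice_cmod: "nice g \<Longrightarrow> nice (\<lambda>x. complex_of_real (cmod (g x)))"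
  unfolding nice_def
  by (auto simp: bounded_iff intro!: continuous_intros Bochner_Integration.integrable_bound[where f=g] dest: borel_measurable_integrable)

text \<open>The triangle inequality under the integral erases both the phase of \<open>g\<close> and
  the modulation, and nonnegativity of \<open>\<phi>\<close> leaves exactly the convolution of the
  moduli. This is how the modulus moves energy from any frequency to the origin.\<close>

lemma sqnorm_conv_modulated_le:
  fixes \<phi> :: "'a::euclidean_space \<Rightarrow> real"
  assumes "\<And>x. 0 \<le> \<phi> x"
  shows "sqnorm (conv g (\<lambda>x. complex_of_real (\<phi> x) * chi (h x))) \<le> sqnorm (conv (\<lambda>x. complex_of_real (cmod (g x))) (\<lambda>x. complex_of_real (\<phi> x)))"
  unfolding sqnorm_def
proof (intro nn_integral_mono ennreal_leI power_mono norm_ge_zero)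
  fix x
  have "cmod (conv g (\<lambda>x. complex_of_real (\<phi> x) * chi (h x)) x) \<le> (LINT y|lborel. cmod (g y) * \<phi> (x - y))"
    unfolding conv_def using assms by (intro order_trans[OF integral_norm_bound]) (simp add: norm_mult)
  also have "\<dots> \<le> cmod (complex_of_real (LINT y|lborel. cmod (g y) * \<phi> (x - y)))"
    by simp
  also have "complex_of_real (LINT y|lborel. cmod (g y) * \<phi> (x - y)) = conv (\<lambda>x. complex_of_real (cmod (g x))) (\<lambda>x. complex_of_real (\<phi> x)) x"
    unfolding conv_def by (subst integral_complex_of_real[symmetric]) simp
  finally show "cmod (conv g (\<lambda>x. complex_of_real (\<phi> x) * chi (h x)) x)
    \<le> cmod (conv (\<lambda>x. complex_of_real (cmod (g x))) (\<lambda>x. complex_of_real (\<phi> x)) x)" .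
qed

lemma ft_modulated: "ft (\<lambda>x. f x * chi (- (x \<bullet> a))) \<xi> = ft f (\<xi> - a)"
  by (simp add: ft_def mult.assoc chi_add[symmetric] inner_diff_right)

text \<open>The energy of \<open>ft g\<close> on the ball about \<open>a i\<close> is seen by the
  filter modulated to that centre, hence bounded by the low-pass output of the modulus of
  \<open>g\<close>. Summation over the covering balls gives the factor \<open>N\<close>.\<close>

lemma modulus_low_pass_nice:
  fixes g f0 :: "'a::euclidean_space \<Rightarrow> complex" and \<phi> :: "'a \<Rightarrow> real"
  assumes g: "nice g" and g': "integrable lborel (ft g)"
    and f0: "integrable lborel f0"
    and low: "\<And>\<xi>. norm \<xi> < \<delta> \<Longrightarrow> 1 / 2 \<le> cmod (ft f0 \<xi>)"
    and \<phi>: "\<And>x. 0 \<le> \<phi> x" "integrable lborel \<phi>" "\<And>\<xi>. cmod (ft (\<lambda>x. complex_of_real (\<phi> x)) \<xi>) \<le> 1 / 2"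
    "\<And>\<xi>. \<delta> \<le> norm \<xi> \<Longrightarrow> ft (\<lambda>x. complex_of_real (\<phi> x)) \<xi> = 0"
    "\<And>\<xi>. norm \<xi> < r \<Longrightarrow> c \<le> cmod (ft (\<lambda>x. complex_of_real (\<phi> x)) \<xi>)" and "0 \<le> c"
    and cover: "\<And>\<xi>. ft g \<xi> \<noteq> 0 \<Longrightarrow> \<exists>i<N::nat. norm (\<xi> - a i) < r"
  shows "ennreal (c\<^sup>2) * sqnorm g \<le> of_nat N * sqnorm (conv (\<lambda>x. complex_of_real (cmod (g x))) f0)"
proof -
  let ?\<phi> = "\<lambda>x. complex_of_real (\<phi> x)" and ?h = "\<lambda>x. complex_of_real (cmod (g x))"
  have int\<phi>: "integrable lborel ?\<phi>" using \<phi>(2) by simp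
  note h = nice_cmod[OF g]
  have bl: "band_limited ?\<phi>"
    unfolding band_limited_def by (intro exI[of _ "cball 0 \<delta>"]) (auto intro: \<phi>(4))
  note [measurable] = ft_measurable[OF nice_integrable[OF g]] borel_measurable_integrable[OF \<phi>(2)]
  have 1: "(\<integral>\<^sup>+\<xi>. ennreal (c\<^sup>2) * (ennreal ((cmod (ft g \<xi>))\<^sup>2) * indicator (ball (a i) r) \<xi>) \<partial>lborel) \<le> sqnorm (conv ?h f0)" for i
  proof -
    have "(\<integral>\<^sup>+\<xi>. ennreal (c\<^sup>2) * (ennreal ((cmod (ft g \<xi>))\<^sup>2) * indicator (ball (a i) r) \<xi>) \<partial>lborel)
       \<le> (\<integral>\<^sup>+\<xi>. ennreal ((cmod (ft g \<xi>))\<^sup>2 * (cmod (ft ?\<phi> (\<xi> - a i)))\<^sup>2) \<partial>lborel)"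
    proof (rule nn_integral_mono)
      fix \<xi>
      show "ennreal (c\<^sup>2) * (ennreal ((cmod (ft g \<xi>))\<^sup>2) * indicator (ball (a i) r) \<xi>) \<le> ennreal ((cmod (ft g \<xi>))\<^sup>2 * (cmod (ft ?\<phi> (\<xi> - a i)))\<^sup>2)"
      proof (cases "\<xi> \<in> ball (a i) r")
        case True
        then have "c\<^sup>2 \<le> (cmod (ft ?\<phi> (\<xi> - a i)))\<^sup>2"
          using \<open>0 \<le> c\<close> by (intro power_mono \<phi>(5)) (auto simp: dist_norm norm_minus_commute)
        from mult_left_mono[OF this, of "(cmod (ft g \<xi>))\<^sup>2"] True show ?thesis
          by (simp add: ennreal_mult[symmetric] mult.commute ennreal_leI)
      qed simp
    qed
    also have "\<dots> = (\<integral>\<^sup>+\<xi>. ennreal ((cmod (ft g \<xi>))\<^sup>2 * (cmod (ft (\<lambda>x. ?\<phi> x * chi (- (x \<bullet> a i))) \<xi>))\<^sup>2) \<partial>lborel)"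
      by (simp add: ft_modulated)
    also have "\<dots> \<le> sqnorm (conv g (\<lambda>x. ?\<phi> x * chi (- (x \<bullet> a i))))"
      by (intro ft_le_sqnorm_conv nice_integrable g integrable_mult_chi int\<phi>) simp
    also have "\<dots> \<le> sqnorm (conv ?h ?\<phi>)"
      by (rule sqnorm_conv_modulated_le[OF \<phi>(1)])
    also have "\<dots> \<le> (\<integral>\<^sup>+\<xi>. ennreal ((cmod (ft ?h \<xi>))\<^sup>2 * (cmod (ft ?\<phi> \<xi>))\<^sup>2) \<partial>lborel)"
      by (rule sqnorm_conv_le_ft[OF h int\<phi> bl])
    \<comment> \<open>The multipliers compare pointwise: inside radius \<open>\<delta>\<close> the
      value 1/2 separates them, and outside it the transform of \<open>\<phi>\<close>
      vanishes.\<close>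
    also have "\<dots> \<le> (\<integral>\<^sup>+\<xi>. ennreal ((cmod (ft ?h \<xi>))\<^sup>2 * (cmod (ft f0 \<xi>))\<^sup>2) \<partial>lborel)"
    proof (intro nn_integral_mono ennreal_leI mult_left_mono power_mono)
      show "cmod (ft ?\<phi> \<xi>) \<le> cmod (ft f0 \<xi>)" for \<xi>
        using \<phi>(3)[of \<xi>] \<phi>(4)[of \<xi>] low[of \<xi>] by (cases "norm \<xi> < \<delta>") auto
    qed auto
    also have "\<dots> \<le> sqnorm (conv ?h f0)"
      by (rule ft_le_sqnorm_conv[OF nice_integrable[OF h] f0])
    finally show ?thesis .
  qed
  have "ennreal (c\<^sup>2) * sqnorm g \<le> ennreal (c\<^sup>2) * sqnorm (ft g)"
    by (intro mult_left_mono sqnorm_le_sqnorm_ft g g') simp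
  also have "\<dots> \<le> ennreal (c\<^sup>2) * (\<integral>\<^sup>+\<xi>. (\<Sum>i<N. ennreal ((cmod (ft g \<xi>))\<^sup>2) * indicator (ball (a i) r) \<xi>) \<partial>lborel)"
    unfolding sqnorm_def
  proof (intro mult_left_mono nn_integral_mono)
    fix \<xi>
    show "ennreal ((cmod (ft g \<xi>))\<^sup>2) \<le> (\<Sum>i<N. ennreal ((cmod (ft g \<xi>))\<^sup>2) * indicator (ball (a i) r) \<xi>)"
    proof (cases "ft g \<xi> = 0")
      case False
      then obtain i where i: "i < N" "norm (\<xi> - a i) < r" using cover by blast
      have "ennreal ((cmod (ft g \<xi>))\<^sup>2) = ennreal ((cmod (ft g \<xi>))\<^sup>2) * indicator (ball (a i) r) \<xi>"
        using i by (simp add: dist_norm norm_minus_commute)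
      also have "\<dots> \<le> (\<Sum>i<N. ennreal ((cmod (ft g \<xi>))\<^sup>2) * indicator (ball (a i) r) \<xi>)"
        using i by (intro member_le_sum) auto
      finally show ?thesis .
    qed simp
  qed simp
  also have "\<dots> = (\<Sum>i<N. \<integral>\<^sup>+\<xi>. ennreal (c\<^sup>2) * (ennreal ((cmod (ft g \<xi>))\<^sup>2) * indicator (ball (a i) r) \<xi>) \<partial>lborel)"
  proof -
    have m: "(\<lambda>\<xi>. ennreal ((cmod (ft g \<xi>))\<^sup>2) * indicator (ball (a i) r) \<xi>) \<in> borel_measurable lborel" for i
      by (intro borel_measurable_times_ennreal borel_measurable_indicator) simp_all
    show ?thesis
      unfolding nn_integral_sum[OF m] sum_distrib_left nn_integral_cmult[OF m] ..
  qed
  also have "\<dots> \<le> (\<Sum>i<N. sqnorm (conv ?h f0))"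
    by (intro sum_mono 1)
  finally show ?thesis by simp
qed

text \<open>The frame bound for a family consisting of a single filter.\<close>

lemma sqnorm_conv_le:
  assumes "f \<in> borel_measurable borel" "sqnorm f < \<infinity>" "integrable lborel g" "band_limited g" "sqnorm g < \<infinity>"
    and "\<And>\<xi>. cmod (ft g \<xi>) \<le> 1"
  shows "sqnorm (conv f g) \<le> sqnorm f"
  using frame_bound[of f "{()}" "\<lambda>_. g"] assms by (simp add: power_le_one)

text \<open>Passing from \<open>nice\<close> functions to the whole of \<open>L\<^sup>2\<close> by density costs a factor 4,
  because \<open>\<parallel>a + b\<parallel>\<^sup>2 \<le> 2 \<parallel>a\<parallel>\<^sup>2 + 2 \<parallel>b\<parallel>\<^sup>2\<close> is used twice.\<close>

lemma modulus_low_pass: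
  fixes f g f0 :: "'a::euclidean_space \<Rightarrow> complex" and \<phi> :: "'a \<Rightarrow> real"
  assumes [measurable]: "f \<in> borel_measurable borel" and f: "sqnorm f < \<infinity>"
    and g: "integrable lborel g" "band_limited g" "sqnorm g < \<infinity>" "\<And>\<xi>. cmod (ft g \<xi>) \<le> 1"
    and f0: "integrable lborel f0" "band_limited f0" "sqnorm f0 < \<infinity>" "\<And>\<xi>. cmod (ft f0 \<xi>) \<le> 1"
    and low: "\<And>\<xi>. norm \<xi> < \<delta> \<Longrightarrow> 1 / 2 \<le> cmod (ft f0 \<xi>)"
    and \<phi>: "\<And>x. 0 \<le> \<phi> x" "integrable lborel \<phi>" "\<And>\<xi>. cmod (ft (\<lambda>x. complex_of_real (\<phi> x)) \<xi>) \<le> 1 / 2"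
    "\<And>\<xi>. \<delta> \<le> norm \<xi> \<Longrightarrow> ft (\<lambda>x. complex_of_real (\<phi> x)) \<xi> = 0"
    "\<And>\<xi>. norm \<xi> < r \<Longrightarrow> c \<le> cmod (ft (\<lambda>x. complex_of_real (\<phi> x)) \<xi>)" and "0 \<le> c"
    and cover: "\<And>\<xi>. ft g \<xi> \<noteq> 0 \<Longrightarrow> \<exists>i<N::nat. norm (\<xi> - a i) < r"
  shows "ennreal (c\<^sup>2) * sqnorm (conv f g) \<le> 4 * of_nat N * sqnorm (conv (\<lambda>x. complex_of_real (cmod (conv f g x))) f0)"
proof -
  obtain u where u: "\<And>n. nice (u n)" "(\<lambda>n. sqnorm (\<lambda>x. u n x - f x)) \<longlonglongrightarrow> 0"
    by (rule nice_approx[OF assms(1) f]) (rule that)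
  note [measurable] = nice_measurable[OF u(1)] borel_measurable_integrable[OF g(1)] borel_measurable_integrable[OF f0(1)]
  note fin_u = nice_sqnorm_finite[OF u(1)]
  let ?G = "conv f g" and ?H = "\<lambda>n. conv (u n) g" and ?N = "of_nat N :: ennreal"
  let ?a = "\<lambda>h x. complex_of_real (cmod (h x))"
  have fin_G: "sqnorm ?G < \<infinity>"
    using sqnorm_conv_le[OF assms(1) f g] f by (rule le_less_trans)
  have fin_H: "sqnorm (?H n) < \<infinity>" for n
    using sqnorm_conv_le[OF _ fin_u g] fin_u by (rule le_less_trans) simp
  have sqnorm_a: "sqnorm (?a h) = sqnorm h" for h :: "'a \<Rightarrow> complex" by (simp add: sqnorm_def)
  have d: "sqnorm (\<lambda>x. ?H n x - ?G x) \<le> sqnorm (\<lambda>x. u n x - f x)" for n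
  proof -
    have "(\<lambda>x. ?H n x - ?G x) = conv (\<lambda>x. u n x - f x) g"
      using fin_u f g by (intro ext conv_diff[symmetric]) auto
    then show ?thesis
      using sqnorm_conv_le[OF _ sqnorm_diff_finite[OF _ _ fin_u f] g] by simp
  qed
  \<comment> \<open>Neither the two convolutions nor the modulus between them increases L2
    distances; for the modulus this is the reverse triangle inequality.\<close>
  have da: "sqnorm (\<lambda>x. conv (?a (?H n)) f0 x - conv (?a ?G) f0 x) \<le> sqnorm (\<lambda>x. u n x - f x)" for n
  proof -
    have "(\<lambda>x. conv (?a (?H n)) f0 x - conv (?a ?G) f0 x) = conv (\<lambda>x. ?a (?H n) x - ?a ?G x) f0"
      using fin_H fin_G f0 by (intro ext conv_diff[symmetric]) (auto simp: sqnorm_a)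
    then have "sqnorm (\<lambda>x. conv (?a (?H n)) f0 x - conv (?a ?G) f0 x) \<le> sqnorm (\<lambda>x. ?a (?H n) x - ?a ?G x)"
      using sqnorm_conv_le[OF _ sqnorm_diff_finite[of "?a (?H n)" "?a ?G"] f0] fin_H fin_G by (simp add: sqnorm_a)
    also have "\<dots> \<le> sqnorm (\<lambda>x. ?H n x - ?G x)"
      unfolding sqnorm_def of_real_diff[symmetric] norm_of_real
      by (intro nn_integral_mono ennreal_leI power_mono norm_triangle_ineq3) simp
    also note d
    finally show ?thesis .
  qed
  have H: "ennreal (c\<^sup>2) * sqnorm (?H n) \<le> ?N * sqnorm (conv (?a (?H n)) f0)" for n
    by (rule modulus_low_pass_nice[OF nice_conv[OF u(1) g(1)] integrable_ft_conv[OF nice_integrable[OF u(1)] g(1,2)] f0(1) low \<phi> \<open>0 \<le> c\<close>, where N=N and a=a])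
       (use cover in \<open>auto simp: ft_conv nice_integrable[OF u(1)] g\<close>)
  have le: "ennreal (c\<^sup>2) * sqnorm ?G \<le> 4 * ?N * sqnorm (conv (?a ?G) f0) + (4 * ?N + 2 * ennreal (c\<^sup>2)) * sqnorm (\<lambda>x. u n x - f x)" for n
  proof -
    have "sqnorm ?G \<le> 2 * sqnorm (?H n) + 2 * sqnorm (\<lambda>x. ?G x - ?H n x)"
      using sqnorm_add_le2[of "?H n" "\<lambda>x. ?G x - ?H n x"] by simp
    also have "\<dots> \<le> 2 * sqnorm (?H n) + 2 * sqnorm (\<lambda>x. u n x - f x)"
      using d[of n] by (intro add_mono mult_left_mono) (auto simp: sqnorm_minus_commute[of ?G])
    finally have "ennreal (c\<^sup>2) * sqnorm ?G \<le> ennreal (c\<^sup>2) * (2 * sqnorm (?H n) + 2 * sqnorm (\<lambda>x. u n x - f x))"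
      by (rule mult_left_mono) simp
    also have "\<dots> = 2 * (ennreal (c\<^sup>2) * sqnorm (?H n)) + 2 * ennreal (c\<^sup>2) * sqnorm (\<lambda>x. u n x - f x)"
      by (simp add: distrib_left mult_ac)
    also have "\<dots> \<le> 2 * (?N * sqnorm (conv (?a (?H n)) f0)) + 2 * ennreal (c\<^sup>2) * sqnorm (\<lambda>x. u n x - f x)"
      by (intro add_mono mult_left_mono H) auto
    also have "sqnorm (conv (?a (?H n)) f0) \<le> 2 * sqnorm (conv (?a ?G) f0) + 2 * sqnorm (\<lambda>x. conv (?a (?H n)) f0 x - conv (?a ?G) f0 x)"
      using sqnorm_add_le2[of "conv (?a ?G) f0" "\<lambda>x. conv (?a (?H n)) f0 x - conv (?a ?G) f0 x"] by simp
    also have "\<dots> \<le> 2 * sqnorm (conv (?a ?G) f0) + 2 * sqnorm (\<lambda>x. u n x - f x)"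
      by (intro add_mono mult_left_mono da) auto
    finally have "ennreal (c\<^sup>2) * sqnorm ?G \<le> 2 * (?N * (2 * sqnorm (conv (?a ?G) f0) + 2 * sqnorm (\<lambda>x. u n x - f x))) + 2 * ennreal (c\<^sup>2) * sqnorm (\<lambda>x. u n x - f x)"
      by (simp add: mult_left_mono add_mono)
    also have "\<dots> = 4 * ?N * sqnorm (conv (?a ?G) f0) + (4 * ?N + 2 * ennreal (c\<^sup>2)) * sqnorm (\<lambda>x. u n x - f x)"
      by (simp add: distrib_left distrib_right mult.assoc[symmetric] add.assoc mult.commute[of ?N])
    finally show ?thesis .
  qed
  have "(\<lambda>n. 4 * ?N * sqnorm (conv (?a ?G) f0) + (4 * ?N + 2 * ennreal (c\<^sup>2)) * sqnorm (\<lambda>x. u n x - f x)) \<longlonglongrightarrow>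
     4 * ?N * sqnorm (conv (?a ?G) f0) + (4 * ?N + 2 * ennreal (c\<^sup>2)) * 0"
    by (intro tendsto_add tendsto_const tendsto_mult_ennreal u(2)) (auto simp: ennreal_mult_eq_top_iff)
  from LIMSEQ_le_const[OF this, of "ennreal (c\<^sup>2) * sqnorm ?G"] show ?thesis
    using le by simp
qed

section \<open>Passage to Lebesgue measurable functions\<close>

lemma borel_version:
  fixes f :: "'a::euclidean_space \<Rightarrow> complex"
  assumes [measurable]: "f \<in> borel_measurable lebesgue"
  obtains f' where "f' \<in> borel_measurable borel" "AE x in lborel. f x = f' x"
proof -
  obtain u where u: "u \<in> borel_measurable lborel" "AE x in lborel. Re (f x) = u x"
    using completion_ex_borel_measurable_real[of "\<lambda>x. Re (f x)" lborel] by auto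
  obtain v where v: "v \<in> borel_measurable lborel" "AE x in lborel. Im (f x) = v x"
    using completion_ex_borel_measurable_real[of "\<lambda>x. Im (f x)" lborel] by auto
  have [measurable]: "u \<in> borel_measurable borel" "v \<in> borel_measurable borel"
    using u(1) v(1) by auto
  show ?thesis
  proof (rule that[of "\<lambda>x. complex_of_real (u x) + \<i> * complex_of_real (v x)"])
    show "AE x in lborel. f x = complex_of_real (u x) + \<i> * complex_of_real (v x)"
      using u(2) v(2) by eventually_elim (metis complex_eq)
  qed measurable
qed

lemma AE_lebesgue_iff: "(AE x in lebesgue. Q x) \<longleftrightarrow> (AE x in lborel. Q x)"
  by (rule AE_completion_iff)

lemma borel_measurable_lebesgueI:
  "f \<in> borel_measurable borel \<Longrightarrow> f \<in> borel_measurable lebesgue"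
  by (rule measurable_completion) simp

lemma integral_lebesgue_eq_lborel:
  fixes f g :: "'a::euclidean_space \<Rightarrow> complex"
  assumes "f \<in> borel_measurable lebesgue" "g \<in> borel_measurable borel" "AE x in lborel. f x = g x"
  shows "(LINT x|lebesgue. f x) = (LINT x|lborel. g x)"
proof -
  have "(LINT x|lebesgue. f x) = (LINT x|lebesgue. g x)"
    using assms borel_measurable_lebesgueI[OF assms(2)] by (intro integral_cong_AE) (simp_all add: AE_lebesgue_iff)
  also have "\<dots> = (LINT x|lborel. g x)"
    using assms(2) by (intro integral_completion) simp
  finally show ?thesis .
qed

lemma L2_norm_sq_eq_sqnorm: "L2_norm_sq f = sqnorm f"
  by (simp add: L2_norm_sq_def sqnorm_def nn_integral_completion)

lemma sqnorm_cong_AE: "AE x in lborel. f x = g x \<Longrightarrow> sqnorm f = sqnorm g"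
  unfolding sqnorm_def by (intro nn_integral_cong_AE) auto

lemma in_L2_sqnorm: "in_L2 f \<Longrightarrow> sqnorm f < \<infinity>"
  by (simp add: L2_norm_sq_eq_sqnorm[symmetric] L2_norm_sq_def in_L2_def integrable_iff_bounded)

lemma in_L1_integrable:
  assumes "in_L1 f" "f' \<in> borel_measurable borel" "AE x in lborel. f x = f' x"
  shows "integrable lborel f'"
proof -
  have "integrable lebesgue f'"
    using assms by (subst integrable_cong_AE[of _ _ f])
      (auto simp: in_L1_def AE_lebesgue_iff intro: borel_measurable_lebesgueI dest: borel_measurable_integrable)
  then show ?thesis
    using assms(2) by (simp add: integrable_completion)
qed

lemma fourier_eq_ft:
  fixes f f' :: "real^'d \<Rightarrow> complex"
  assumes "f \<in> borel_measurable lebesgue" "f' \<in> borel_measurable borel" "AE x in lborel. f x = f' x"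
  shows "fourier f = ft f'"
proof
  fix \<xi> :: "real^'d"
  note [measurable] = assms(1,2)
  have "(\<lambda>x. chi (x \<bullet> \<xi>)) \<in> borel_measurable lebesgue"
    by (rule borel_measurable_lebesgueI) measurable
  with assms show "fourier f \<xi> = ft f' \<xi>"
    unfolding fourier_def ft_def chi_def[symmetric]
    by (intro integral_lebesgue_eq_lborel) auto
qed

text \<open>The map \<open>y \<mapsto> x - y\<close> preserves null sets; the integrand of a
  convolution evaluates its second factor along this map.\<close>

lemma AE_lborel_reflect:
  fixes x :: "'a::euclidean_space"
  assumes "AE y in lborel. Q y"
  shows "AE y in lborel. Q (x - y)"
proof -
  obtain N where N: "{y \<in> space lborel. \<not> Q y} \<subseteq> N" "emeasure lborel N = 0" "N \<in> sets lborel"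
    by (rule AE_E[OF assms])
  have [measurable]: "(\<lambda>y. x - y) -` N \<in> sets borel"
    using measurable_sets[of "\<lambda>y. x - y" borel borel N] N(3) by simp
  have "(\<integral>\<^sup>+y. indicator ((\<lambda>y. x - y) -` N) y \<partial>lborel) = (\<integral>\<^sup>+y. indicator N (x - y) \<partial>lborel)"
    by (intro nn_integral_cong) (simp add: indicator_def)
  also have "\<dots> = (\<integral>\<^sup>+y. indicator N y \<partial>lborel)"
    using nn_integral_lborel_affine[of "indicator N" "-1" x] N(3) by simp
  finally have "emeasure lborel ((\<lambda>y. x - y) -` N) = 0"
    using N by simp
  then show ?thesis
    using N(1) by (intro AE_I[where N="(\<lambda>y. x - y) -` N"]) auto
qed

text \<open>Changing the factors on null sets changes the integrand only on a null set, for each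
  fixed \<open>x\<close>. The equality therefore holds at every point, not just almost
  everywhere.\<close>

lemma convolution_eq_conv:
  fixes f f' g g' :: "real^'d \<Rightarrow> complex"
  assumes f: "f \<in> borel_measurable lebesgue" "f' \<in> borel_measurable borel" "AE x in lborel. f x = f' x"
    and g: "g \<in> borel_measurable lebesgue" "g' \<in> borel_measurable borel" "AE x in lborel. g x = g' x"
  shows "convolution f g = conv f' g'"
proof
  fix x :: "real^'d"
  note [measurable] = f(1,2) g(1,2)
  have "(\<lambda>y. x - y) \<in> lebesgue \<rightarrow>\<^sub>M lebesgue"
    using lebesgue_affine_measurable[of "\<lambda>_. -1" x] by (simp add: sum_negf euclidean_representation)
  from measurable_compose[OF this g(1)] have [measurable]: "(\<lambda>y. g (x - y)) \<in> borel_measurable lebesgue" .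
  have "AE y in lborel. f y * g (x - y) = f' y * g' (x - y)"
    using f(3) AE_lborel_reflect[OF g(3), of x] by eventually_elim simp
  then show "convolution f g x = conv f' g' x"
    unfolding convolution_def conv_def by (intro integral_lebesgue_eq_lborel) auto
qed

text \<open>Near such a point the set where \<open>h\<close> is nonzero would be open, nonempty and
  null. Thus the support conditions on the frame become pointwise ones.\<close>

lemma continuous_zero_outside_ess_supp:
  assumes cont: "continuous_on UNIV h" and \<xi>: "\<xi> \<notin> ess_supp h"
  shows "h \<xi> = 0"
proof (rule ccontr)
  assume ne: "h \<xi> \<noteq> 0"
  obtain V where V: "open V" "\<xi> \<in> V" "AE x in lebesgue. x \<in> V \<longrightarrow> h x = 0"
    using \<xi> by (auto simp: ess_supp_def)
  define W where "W = V \<inter> h -` (- {0})"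
  have "open W"
    unfolding W_def using cont V(1) by (intro open_Int open_vimage) auto
  moreover have "\<xi> \<in> W"
    using V ne by (simp add: W_def)
  ultimately have "\<not> negligible W"
    by (intro open_not_negligible) auto
  moreover have "AE x in lebesgue. x \<notin> W"
    using V(3) by eventually_elim (auto simp: W_def)
  then have "W \<in> null_sets lebesgue"
    using \<open>open W\<close> by (subst (asm) AE_iff_null_sets[symmetric]) auto
  ultimately show False
    by (simp add: negligible_iff_null_sets)
qed

lemma propagator_snoc: "propagator F (ps @ [p]) f = (\<lambda>x. complex_of_real (cmod (convolution (propagator F ps f) (F p) x)))"
  by (simp add: propagator_def propagator1_def)

text \<open>\<open>T\<close> is the input energy, \<open>Y\<close> the low-pass output and
  \<open>X\<close> the energy passed on. Finiteness of \<open>T\<close> allows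
  \<open>ennreal a * T\<close> to be cancelled.\<close>

lemma ennreal_contraction:
  fixes X Y T :: ennreal
  assumes "X + Y \<le> T" "ennreal a * T \<le> Y" "T < \<infinity>" "0 \<le> a" "a \<le> 1"
  shows "X \<le> ennreal (1 - a) * T"
proof -
  obtain t where t: "T = ennreal t" "0 \<le> t" using assms(3) by (cases T) auto
  have "X + ennreal a * T \<le> T"
    using assms(1,2) by (metis add_left_mono order_trans)
  also have "T = ennreal (1 - a) * T + ennreal a * T"
    using assms by (simp add: distrib_right[symmetric] ennreal_plus[symmetric] del: ennreal_plus)
  finally have "ennreal a * T + X \<le> ennreal a * T + ennreal (1 - a) * T"
    by (simp add: add.commute)
  then show ?thesis
    using t by (simp only: ennreal_add_left_cancel_le) (auto simp: ennreal_mult_eq_top_iff)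
qed

text \<open>Indexing by \<open>'p option\<close>, with \<open>None\<close> for \<open>f0\<close>,
  turns the low-pass filter and the others into one family to which \<open>frame_bound\<close>
  applies.\<close>

lemma exists_frame_borel_version:
  fixes P :: "'p set" and f0 :: "real^'d \<Rightarrow> complex" and F :: "'p \<Rightarrow> real^'d \<Rightarrow> complex"
  assumes frame: "uniform_covering_frame P f0 F"
  obtains G :: "'p option \<Rightarrow> real^'d \<Rightarrow> complex" where
    "\<And>i. i \<in> insert None (Some ` P) \<Longrightarrow> G i \<in> borel_measurable borel"
    "\<And>i. i \<in> insert None (Some ` P) \<Longrightarrow> AE x in lborel. case_option f0 F i x = G i x"
proof -
  have "\<exists>g. i \<in> insert None (Some ` P) \<longrightarrow> g \<in> borel_measurable borel \<and> (AE x in lborel. case_option f0 F i x = g x)" for i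
  proof (cases "i \<in> insert None (Some ` P)")
    case True
    then have "in_L2 (case_option f0 F i)"
      using frame by (auto simp: uniform_covering_frame_def)
    then have "case_option f0 F i \<in> borel_measurable lebesgue"
      by (simp add: in_L2_def)
    then show ?thesis
      by (rule borel_version) blast
  qed blast
  then show ?thesis
    using that by metis
qed

section \<open>Energy decay along paths\<close>

text \<open>A finite set of paths lies in the product of its prefixes \<open>A\<close> and its last
  entries \<open>B\<close>, and the one-step estimate is summed over \<open>A\<close>. Prefixes have
  length at least 1, as the contraction is available for signals that are already moduli.\<close>

lemma sum_paths_contraction:
  fixes E :: "'p list \<Rightarrow> ennreal"
  assumes step: "\<And>q B. q \<in> paths P (Suc k) \<Longrightarrow> finite B \<Longrightarrow> B \<subseteq> P \<Longrightarrow> (\<Sum>p\<in>B. E (q @ [p])) \<le> C * E q"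
    and T: "finite T" "T \<subseteq> paths P (Suc (Suc k))"
  shows "\<exists>A. finite A \<and> A \<subseteq> paths P (Suc k) \<and> sum E T \<le> C * sum E A"
proof -
  define A where "A = butlast ` T"
  define B where "B = last ` T"
  have len: "ps \<noteq> []" if "ps \<in> T" for ps
    using T(2) that by (auto simp: paths_def)
  have A: "finite A" "A \<subseteq> paths P (Suc k)"
    using T by (auto simp: A_def paths_def dest!: in_set_butlastD)
  have B: "finite B" "B \<subseteq> P"
    using T len last_in_set by (fastforce simp: B_def paths_def)+
  have inj: "inj_on (\<lambda>(q, p). q @ [p]) (A \<times> B)"
    by (auto simp: inj_on_def)
  have "T \<subseteq> (\<lambda>(q, p). q @ [p]) ` (A \<times> B)"
  proof
    fix ps assume ps: "ps \<in> T"
    then have "ps = (\<lambda>(q, p). q @ [p]) (butlast ps, last ps)"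
      using len by simp
    moreover have "(butlast ps, last ps) \<in> A \<times> B"
      using ps by (auto simp: A_def B_def)
    ultimately show "ps \<in> (\<lambda>(q, p). q @ [p]) ` (A \<times> B)"
      by (rule image_eqI)
  qed
  then have "sum E T \<le> sum E ((\<lambda>(q, p). q @ [p]) ` (A \<times> B))"
    using A B by (intro sum_mono2) auto
  also have "\<dots> = (\<Sum>q\<in>A. \<Sum>p\<in>B. E (q @ [p]))"
    by (subst sum.reindex[OF inj]) (simp add: sum.cartesian_product case_prod_unfold comp_def)
  also have "\<dots> \<le> (\<Sum>q\<in>A. C * E q)"
    using A B by (intro sum_mono step) auto
  also have "\<dots> = C * sum E A"
    by (simp add: sum_distrib_left)
  finally show ?thesis
    using A by blast
qed

text \<open>An infinite sum in \<open>ennreal\<close> is the supremum of its finite partial sums.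
  Truncated subtraction carries \<open>X\<close> to the right side and back again, the latter
  because \<open>X \<le> Y\<close>.\<close>

lemma add_infsum_ennreal_le:
  fixes X Y :: ennreal and E :: "'a \<Rightarrow> ennreal"
  assumes "\<And>T. finite T \<Longrightarrow> T \<subseteq> A \<Longrightarrow> X + sum E T \<le> Y" and "X < \<infinity>"
  shows "X + infsum E A \<le> Y"
proof -
  have XY: "X \<le> Y" using assms(1)[of "{}"] by simp
  have "infsum E A \<le> Y - X"
  proof (rule infsum_le_finite_sums)
    fix T assume "finite T" "T \<subseteq> A"
    then show "sum E T \<le> Y - X"
      using assms(1)[of T] by (simp add: ennreal_le_minus_iff add.commute)
  qed (rule nonneg_summable_on_complete, simp)
  then have "X + infsum E A \<le> X + (Y - X)"
    by (rule add_left_mono)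
  with XY show ?thesis by (simp only: add_diff_inverse_ennreal)
qed

theorem proposition3p3:
  fixes P :: "'p set"
    and f0 :: "real^'d \<Rightarrow> complex"
    and F :: "'p \<Rightarrow> real^'d \<Rightarrow> complex"
  assumes "uniform_covering_frame P f0 F"
  shows "\<exists>C0::real. 0 < C0 \<and> C0 < 1 \<and>
    (\<forall>f :: real^'d \<Rightarrow> complex. \<forall>K::nat. in_L2 f \<longrightarrow> K \<ge> 1 \<longrightarrow>
       ennreal (C0 ^ (K - 1)) * L2_norm_sq (convolution f f0)
         + (\<Sum>\<^sub>\<infinity>ps\<in>paths P K. L2_norm_sq (propagator F ps f))
       \<le> ennreal (C0 ^ (K - 1)) * L2_norm_sq f)"
proof -

  \<comment> \<open>Borel representatives of the frame and their transforms\<close>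
  let ?F = "case_option f0 F" and ?I = "insert None (Some ` P)"
  obtain G :: "'p option \<Rightarrow> real^'d \<Rightarrow> complex" where
    G_meas: "\<And>i. i \<in> ?I \<Longrightarrow> G i \<in> borel_measurable borel" and
    G_AE: "\<And>i. i \<in> ?I \<Longrightarrow> AE x in lborel. ?F i x = G i x"
    by (rule exists_frame_borel_version[OF assms]) (rule that)
  have F_L: "in_L1 (?F i)" "in_L2 (?F i)" if "i \<in> ?I" for i
    using assms that by (auto simp: uniform_covering_frame_def)
  have F_meas: "?F i \<in> borel_measurable lebesgue" if "i \<in> ?I" for i
    using F_L(2)[OF that] by (simp add: in_L2_def)
  have G_int: "integrable lborel (G i)" if "i \<in> ?I" for i
    using in_L1_integrable[OF F_L(1) G_meas G_AE] that by blast
  have G_sqnorm: "sqnorm (G i) < \<infinity>" if "i \<in> ?I" for i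
    using in_L2_sqnorm[OF F_L(2)[OF that]] sqnorm_cong_AE[OF G_AE[OF that]] by simp
  have ft_G: "fourier (?F i) = ft (G i)" if "i \<in> ?I" for i
    using that by (intro fourier_eq_ft F_meas G_meas G_AE)
  have ess: "ft (G i) \<xi> = 0" if "i \<in> ?I" "\<xi> \<notin> ess_supp (fourier (?F i))" for i \<xi>
    using continuous_zero_outside_ess_supp[of "ft (G i)" \<xi>] continuous_on_ft[OF G_int[OF that(1)]] that ft_G by auto
  have G_bl: "band_limited (G i)" if i: "i \<in> ?I" for i
  proof -
    have "\<exists>S. compact S \<and> ess_supp (fourier (?F i)) \<subseteq> S"
    proof (cases i)
      case None
      then show ?thesis using assms by (auto simp: uniform_covering_frame_def)
    next
      case (Some p)
      then have "compact (ess_supp (fourier (?F i)))"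
        using assms i by (auto simp: uniform_covering_frame_def)
      then show ?thesis by blast
    qed
    then show ?thesis
      unfolding band_limited_def using ess[OF i] by blast
  qed
  have G_sum: "(\<Sum>i\<in>insert None (Some ` S). (cmod (ft (G i) \<xi>))\<^sup>2) \<le> 1" if S: "finite S" "S \<subseteq> P" for S \<xi>
  proof -
    have "(\<Sum>i\<in>insert None (Some ` S). (cmod (ft (G i) \<xi>))\<^sup>2) = (cmod (ft (G None) \<xi>))\<^sup>2 + (\<Sum>p\<in>S. (cmod (ft (G (Some p)) \<xi>))\<^sup>2)"
      using S by (subst sum.insert) (auto simp: sum.reindex)
    also have "\<dots> = (cmod (fourier f0 \<xi>))\<^sup>2 + (\<Sum>p\<in>S. (cmod (fourier (F p) \<xi>))\<^sup>2)"
      using ft_G[of None] ft_G[of "Some p" for p] S(2) by (auto intro!: sum.cong simp: subset_iff)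
    also have "\<dots> \<le> (cmod (fourier f0 \<xi>))\<^sup>2 + (\<Sum>\<^sub>\<infinity>p\<in>P. (cmod (fourier (F p) \<xi>))\<^sup>2)"
      using assms S by (intro add_left_mono finite_sum_le_infsum) (auto simp: uniform_covering_frame_def)
    also have "\<dots> = 1"
      using assms by (simp add: uniform_covering_frame_def)
    finally show ?thesis .
  qed
  have G_le: "cmod (ft (G i) \<xi>) \<le> 1" if "i \<in> ?I" for i \<xi>
  proof -
    obtain S where S: "finite S" "S \<subseteq> P" "i \<in> insert None (Some ` S)"
    proof (cases i)
      case None
      then show thesis using that[of "{}"] by simp
    next
      case (Some p)
      then show thesis using that[of "{p}"] \<open>i \<in> ?I\<close> by auto
    qed
    have "(cmod (ft (G i) \<xi>))\<^sup>2 \<le> (\<Sum>i\<in>insert None (Some ` S). (cmod (ft (G i) \<xi>))\<^sup>2)"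
      using S by (intro member_le_sum) auto
    also have "\<dots> \<le> 1" by (rule G_sum[OF S(1,2)])
    finally show ?thesis by (simp add: power2_le_iff_abs_le[of 1, simplified] abs_square_le_1)
  qed

  \<comment> \<open>Choice of the filter and the constants; energy bounds for one layer\<close>
  define g0 where "g0 = G None"
  note g0 = G_meas[of None, folded g0_def, simplified] G_int[of None, folded g0_def, simplified]
    G_bl[of None, folded g0_def, simplified] G_sqnorm[of None, folded g0_def, simplified] G_le[of None, folded g0_def, simplified]
  have g0_fin: "sqnorm g0 < \<infinity>"
    using g0(4) by simp
  have "cmod (ft g0 0) = 1"
    using assms ft_G[of None] by (simp add: uniform_covering_frame_def g0_def)
  moreover have "isCont (ft g0) 0"
    using continuous_on_ft[OF g0(2)] by (simp add: continuous_on_eq_continuous_at)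
  then obtain \<delta> where \<delta>: "0 < \<delta>" "\<And>\<xi>. norm \<xi> < \<delta> \<Longrightarrow> dist (ft g0 \<xi>) (ft g0 0) < 1 / 2"
    unfolding continuous_at_eps_delta by (metis dist_0_norm dist_commute half_gt_zero zero_less_one)
  ultimately have low: "1 / 2 \<le> cmod (ft g0 \<xi>)" if "norm \<xi> < \<delta>" for \<xi>
    using \<delta>(2)[OF that] norm_triangle_ineq2[of "ft g0 0" "ft g0 \<xi>"] by (simp add: dist_norm norm_minus_commute)
  obtain \<phi> :: "real^'d \<Rightarrow> real" and c r :: real where
    \<phi>: "\<And>x. 0 \<le> \<phi> x" "integrable lborel \<phi>"
      "\<And>\<xi>. cmod (ft (\<lambda>x. complex_of_real (\<phi> x)) \<xi>) \<le> 1 / 2"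
      "\<And>\<xi>. \<delta> \<le> norm \<xi> \<Longrightarrow> ft (\<lambda>x. complex_of_real (\<phi> x)) \<xi> = 0"
      "\<And>\<xi>. norm \<xi> < r \<Longrightarrow> c \<le> cmod (ft (\<lambda>x. complex_of_real (\<phi> x)) \<xi>)" and cr: "0 < c" "0 < r"
    by (rule low_pass_filter[OF \<delta>(1)]) (rule that)
  \<comment> \<open>With this \<open>R\<close>, a cube of half-side \<open>R\<close> lies in the
    Euclidean ball of radius \<open>r\<close> about its centre, since the norm is at most
    \<open>sqrt (real CARD('d))\<close> times the sup norm.\<close>
  define R where "R = r / sqrt (real CARD('d))"
  have "0 < R" using cr by (simp add: R_def)
  then obtain N :: nat where N: "0 < N" and
    cover: "\<And>p. p \<in> P \<Longrightarrow> \<exists>a :: nat \<Rightarrow> real^'d. ess_supp (fourier (F p)) \<subseteq> (\<Union>i<N. cube R (a i))"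
    using assms unfolding uniform_covering_frame_def by metis
  have cube: "norm (y - x) < r" if "y \<in> cube R x" for x y :: "real^'d"
  proof -
    have "norm (y - x) \<le> sqrt (real CARD('d)) * infnorm (y - x)"
      using norm_le_infnorm[of "y - x"] by simp
    also have "\<dots> < sqrt (real CARD('d)) * R"
      using that by (intro mult_strict_left_mono) (auto simp: cube_def)
    finally show ?thesis by (simp add: R_def)
  qed
  \<comment> \<open>The share \<open>c\<^sup>2 / (4 * real N)\<close> is what
    \<open>modulus_low_pass\<close> guarantees; the minimum with 1/2 keeps \<open>1 - a\<close>
    positive. The value depends on the frame and on choices made from it, not on the signal or on
    \<open>p\<close>.\<close>
  define a where "a = min (c\<^sup>2 / (4 * real N)) (1 / 2)"
  have a: "0 < a" "a < 1" "a * (4 * real N) \<le> c\<^sup>2"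
    using cr N by (auto simp: a_def min_def field_simps)
  have lower: "ennreal a * sqnorm (conv h (G (Some p))) \<le> sqnorm (conv (\<lambda>x. complex_of_real (cmod (conv h (G (Some p)) x))) g0)"
    if h: "h \<in> borel_measurable borel" "sqnorm h < \<infinity>" and p: "p \<in> P" for h p
  proof -
    let ?g = "G (Some p)"
    have i: "Some p \<in> ?I" using p by simp
    obtain b where b: "ess_supp (fourier (F p)) \<subseteq> (\<Union>i<N. cube R (b i))"
      using cover[OF p] by blast
    have cov: "\<exists>j<N. norm (\<xi> - b j) < r" if "ft ?g \<xi> \<noteq> 0" for \<xi>
    proof -
      have "\<xi> \<in> ess_supp (fourier (F p))"
        using ess[OF i, of \<xi>] that by auto
      then show ?thesis using b cube by blast
    qed
    have "ennreal (c\<^sup>2) * sqnorm (conv h ?g) \<le> 4 * of_nat N * sqnorm (conv (\<lambda>x. complex_of_real (cmod (conv h ?g x))) g0)"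
      by (rule modulus_low_pass[OF h G_int[OF i] G_bl[OF i] G_sqnorm[OF i] G_le[OF i] g0(2,3) g0_fin g0(5) low \<phi> less_imp_le[OF cr(1)] cov])
    moreover have "ennreal (a * (4 * real N)) * sqnorm (conv h ?g) \<le> ennreal (c\<^sup>2) * sqnorm (conv h ?g)"
      by (intro mult_right_mono ennreal_leI a) simp
    moreover have "ennreal (a * (4 * real N)) = 4 * of_nat N * ennreal a"
      using a by (simp add: ennreal_mult ennreal_of_nat_eq_real_of_nat mult_ac)
    ultimately have "(4 * of_nat N) * (ennreal a * sqnorm (conv h ?g)) \<le> (4 * of_nat N) * sqnorm (conv (\<lambda>x. complex_of_real (cmod (conv h ?g x))) g0)"
      by (simp add: mult.assoc)
    then show ?thesis
      using N by (subst (asm) ennreal_mult_le_mult_iff) (auto simp: ennreal_mult_eq_top_iff)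
  qed
  have upper: "sqnorm (conv h g0) + (\<Sum>p\<in>B. sqnorm (conv h (G (Some p)))) \<le> sqnorm h"
    if h: "h \<in> borel_measurable borel" "sqnorm h < \<infinity>" and B: "finite B" "B \<subseteq> P" for h B
  proof -
    have "(\<Sum>i\<in>insert None (Some ` B). sqnorm (conv h (G i))) \<le> sqnorm h"
      using B by (intro frame_bound h G_int G_bl G_sqnorm G_sum) auto
    then show ?thesis
      using B by (subst (asm) sum.insert) (auto simp: sum.reindex g0_def)
  qed

  \<comment> \<open>Induction on the path length\<close>
  let ?C = "1 - a"
  \<comment> \<open>Here \<open>k\<close> stands for \<open>K - 1\<close>, and the sum runs over
    finite sets of paths of length \<open>k + 1\<close>; the infinite sum is restored at the
    end.\<close>
  have key: "ennreal (?C ^ k) * L2_norm_sq (convolution f f0) + (\<Sum>ps\<in>T. L2_norm_sq (propagator F ps f)) \<le> ennreal (?C ^ k) * L2_norm_sq f"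
    if f: "in_L2 f" and T: "finite T" "T \<subseteq> paths P (Suc k)" for f k T
  proof -
    have f_meas: "f \<in> borel_measurable lebesgue" using f by (simp add: in_L2_def)
    obtain f' where f': "f' \<in> borel_measurable borel" "AE x in lborel. f x = f' x"
      by (rule borel_version[OF f_meas]) (rule that)
    have sqnorm_f: "sqnorm f = sqnorm f'" by (rule sqnorm_cong_AE[OF f'(2)])
    have f'_fin: "sqnorm f' < \<infinity>" using in_L2_sqnorm[OF f] sqnorm_f by simp
    have conv_Some: "convolution u (F p) = conv u' (G (Some p))"
      if "u \<in> borel_measurable lebesgue" "u' \<in> borel_measurable borel" "AE x in lborel. u x = u' x" "p \<in> P" for u u' p
      using convolution_eq_conv[OF that(1-3) F_meas G_meas G_AE, of "Some p"] that(4) by simp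
    have conv_None: "convolution f f0 = conv f' g0"
      using convolution_eq_conv[OF f_meas f' F_meas G_meas G_AE, of None] by (simp add: g0_def)
    \<comment> \<open>Every iterate, including that of the empty path, keeps finite energy and a
      Borel representative, so the estimates for \<open>conv\<close> apply at each layer.\<close>
    have U_borel: "\<exists>h. h \<in> borel_measurable borel \<and> sqnorm h < \<infinity> \<and> propagator F ps f \<in> borel_measurable lebesgue
       \<and> (AE x in lborel. propagator F ps f x = h x)" if "set ps \<subseteq> P" for ps
      using that
    proof (induction ps rule: rev_induct)
      case Nil
      show ?case
        using f' f'_fin f_meas by (auto simp: propagator_def)
    next
      case (snoc p ps)
      then obtain h where h: "h \<in> borel_measurable borel" "sqnorm h < \<infinity>" "propagator F ps f \<in> borel_measurable lebesgue"
        "AE x in lborel. propagator F ps f x = h x"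
        by auto
      have i: "Some p \<in> ?I" using snoc.prems by simp
      let ?h = "\<lambda>x. complex_of_real (cmod (conv h (G (Some p)) x))"
      have eq: "propagator F (ps @ [p]) f = ?h"
        using conv_Some[OF h(3,1,4)] snoc.prems by (simp add: propagator_snoc)
      have m: "?h \<in> borel_measurable borel"
        using conv_measurable[OF h(1) G_meas[OF i]] by measurable
      have "sqnorm ?h = sqnorm (conv h (G (Some p)))" by (simp add: sqnorm_def)
      also have "\<dots> \<le> sqnorm h"
        by (rule sqnorm_conv_le[OF h(1,2) G_int[OF i] G_bl[OF i] G_sqnorm[OF i] G_le[OF i]])
      finally have "sqnorm ?h < \<infinity>" using h(2) by simp
      then show ?case
        using m eq borel_measurable_lebesgueI[OF m] by auto
    qed
    have snoc: "L2_norm_sq (propagator F (q @ [p]) f) = sqnorm (conv h (G (Some p)))"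
      if "propagator F q f \<in> borel_measurable lebesgue" "h \<in> borel_measurable borel"
        "AE x in lborel. propagator F q f x = h x" "p \<in> P" for q p h
      using conv_Some[OF that] by (simp add: L2_norm_sq_eq_sqnorm propagator_snoc sqnorm_def)
    \<comment> \<open>Since \<open>q\<close> is nonempty, its output is the modulus of a convolution
      with the last filter \<open>p'\<close>, so \<open>lower\<close> applies. An arbitrary input
      \<open>f\<close> need not have this form, hence the first layer contributes no factor and the
      exponent is \<open>K - 1\<close>.\<close>
    have step: "(\<Sum>p\<in>B. L2_norm_sq (propagator F (q @ [p]) f)) \<le> ennreal ?C * L2_norm_sq (propagator F q f)"
      if q: "q \<in> paths P (Suc k)" and B: "finite B" "B \<subseteq> P" for q B k
    proof -
      obtain q' p' where q': "q = q' @ [p']" "set q' \<subseteq> P" "p' \<in> P"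
        using q by (cases q rule: rev_cases) (auto simp: paths_def)
      obtain h where h: "h \<in> borel_measurable borel" "sqnorm h < \<infinity>" "propagator F q' f \<in> borel_measurable lebesgue"
        "AE x in lborel. propagator F q' f x = h x"
        using U_borel[OF q'(2)] by auto
      have i: "Some p' \<in> ?I" using q' by simp
      let ?h = "\<lambda>x. complex_of_real (cmod (conv h (G (Some p')) x))"
      have eq: "propagator F q f = ?h"
        using conv_Some[OF h(3,1,4) q'(3)] by (simp add: q' propagator_snoc)
      have m: "?h \<in> borel_measurable borel"
        using conv_measurable[OF h(1) G_meas[OF i]] by measurable
      have n2h: "sqnorm ?h = sqnorm (conv h (G (Some p')))" by (simp add: sqnorm_def)
      also have "\<dots> \<le> sqnorm h"
        by (rule sqnorm_conv_le[OF h(1,2) G_int[OF i] G_bl[OF i] G_sqnorm[OF i] G_le[OF i]])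
      finally have fin: "sqnorm ?h < \<infinity>" using h(2) by simp
      have "(\<Sum>p\<in>B. sqnorm (conv ?h (G (Some p)))) \<le> ennreal ?C * sqnorm ?h"
      proof (rule ennreal_contraction)
        show "(\<Sum>p\<in>B. sqnorm (conv ?h (G (Some p)))) + sqnorm (conv ?h g0) \<le> sqnorm ?h"
          using upper[OF m fin B] by (simp add: add.commute)
        show "ennreal a * sqnorm ?h \<le> sqnorm (conv ?h g0)"
          unfolding n2h by (rule lower[OF h(1,2) q'(3)])
      qed (use fin a in auto)
      moreover have "L2_norm_sq (propagator F (q @ [p]) f) = sqnorm (conv ?h (G (Some p)))" if "p \<in> B" for p
        using that B eq m borel_measurable_lebesgueI[OF m] by (intro snoc) auto
      ultimately show ?thesis
        by (simp add: eq L2_norm_sq_eq_sqnorm)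
    qed
    show ?thesis
      using T
    proof (induction k arbitrary: T)
      \<comment> \<open>Paths of length 1 amount to single filters, and the claim is the frame bound
        without any contraction.\<close>
      case 0
      define B where "B = hd ` T"
      have hd: "ps = [hd ps]" "hd ps \<in> P" if "ps \<in> T" for ps
        using 0 that by (cases ps; force simp: paths_def)+
      have T_eq: "T = (\<lambda>p. [p]) ` B"
        using hd(1) unfolding B_def image_image by auto
      have B: "finite B" "B \<subseteq> P"
        using 0 hd(2) by (auto simp: B_def)
      have "L2_norm_sq (propagator F [p] f) = sqnorm (conv f' (G (Some p)))" if "p \<in> B" for p
        using snoc[of "[]" f' p] f' f_meas that B by (auto simp: propagator_def)
      then have "(\<Sum>ps\<in>T. L2_norm_sq (propagator F ps f)) = (\<Sum>p\<in>B. sqnorm (conv f' (G (Some p))))"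
        by (simp add: T_eq sum.reindex inj_on_def)
      then show ?case
        using upper[OF f'(1) f'_fin B] by (simp add: conv_None L2_norm_sq_eq_sqnorm sqnorm_f)
    next
      case (Suc k)
      have "\<exists>A. finite A \<and> A \<subseteq> paths P (Suc k) \<and>
          (\<Sum>ps\<in>T. L2_norm_sq (propagator F ps f)) \<le> ennreal ?C * (\<Sum>ps\<in>A. L2_norm_sq (propagator F ps f))"
        by (rule sum_paths_contraction[OF _ Suc.prems]) (rule step)
      then obtain A where A: "finite A" "A \<subseteq> paths P (Suc k)"
        "(\<Sum>ps\<in>T. L2_norm_sq (propagator F ps f)) \<le> ennreal ?C * (\<Sum>ps\<in>A. L2_norm_sq (propagator F ps f))"
        by blast
      have C: "ennreal (?C ^ Suc k) = ennreal ?C * ennreal (?C ^ k)"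
        using a by (simp add: ennreal_mult)
      have "ennreal (?C ^ Suc k) * L2_norm_sq (convolution f f0) + (\<Sum>ps\<in>T. L2_norm_sq (propagator F ps f))
        \<le> ennreal (?C ^ Suc k) * L2_norm_sq (convolution f f0) + ennreal ?C * (\<Sum>ps\<in>A. L2_norm_sq (propagator F ps f))"
        by (intro add_left_mono A)
      also have "\<dots> = ennreal ?C * (ennreal (?C ^ k) * L2_norm_sq (convolution f f0) + (\<Sum>ps\<in>A. L2_norm_sq (propagator F ps f)))"
        by (simp only: C distrib_left mult.assoc)
      also have "\<dots> \<le> ennreal ?C * (ennreal (?C ^ k) * L2_norm_sq f)"
        by (intro mult_left_mono Suc.IH A) simp
      also have "\<dots> = ennreal (?C ^ Suc k) * L2_norm_sq f"
        by (simp only: C mult.assoc)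
      finally show ?case .
    qed
  qed

  \<comment> \<open>From finite sets of paths to the infinite sum\<close>
  show ?thesis
  proof (intro exI[of _ ?C] conjI allI impI)
    fix f :: "real^'d \<Rightarrow> complex" and K :: nat
    assume f: "in_L2 f" and K: "1 \<le> K"
    have KS: "Suc (K - 1) = K" using K by simp
    have "L2_norm_sq f < \<infinity>"
      using in_L2_sqnorm[OF f] by (simp add: L2_norm_sq_eq_sqnorm)
    \<comment> \<open>The estimate for the empty set of paths and exponent 0 bounds the low-pass
      term, whose finiteness \<open>add_infsum_ennreal_le\<close> requires.\<close>
    moreover have "L2_norm_sq (convolution f f0) \<le> L2_norm_sq f"
      using key[OF f, of "{}" 0] by simp
    ultimately have fin: "ennreal (?C ^ (K - 1)) * L2_norm_sq (convolution f f0) < \<infinity>"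
      by (auto simp: ennreal_mult_less_top intro: le_less_trans)
    show "ennreal (?C ^ (K - 1)) * L2_norm_sq (convolution f f0) + (\<Sum>\<^sub>\<infinity>ps\<in>paths P K. L2_norm_sq (propagator F ps f))
       \<le> ennreal (?C ^ (K - 1)) * L2_norm_sq f"
      by (rule add_infsum_ennreal_le[OF key[OF f, of _ "K - 1", unfolded KS] fin])
  qed (use a in auto)
qed

end
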